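(* Let $n>2$ be a natural number, and let $\alpha$ be a unitary representation of the dihedral group $D_{2n}$, acting in a Hilbert space $\mathbf{H}_\alpha$, which is unitarily equivalent to $\kappa$ (so $\dim\mathbf{H}_\alpha=n$ and $\mathbf{H}_\alpha\cong\mathbb{C}^n$). Then the following hold. 1. If $n$ is even, then there is no vector $v\in\mathbf{H}_\alpha$ such that $\alpha(D_{2n})v$ has the Haar property. 2. If $n$ is prime, then there exists a nonempty Zariski open set $E\subset\mathbf{H}_\alpha$ such that for every $v\in E$, $\alpha(D_{2n})v$ has the Haar property. 3. If $n$ is prime, then there exists a nonempty Zariski open set $E\subset\mathbf{H}_\alpha$ such that for every $v\in E$, $\alpha(D_{2n})v$ is a frame in $\mathbf{H}_\alpha\cong\mathbb{C}^n$ which is maximally robust to erasures.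
   Context: $D_{2n}=\langle r,s : r^n=s^2=e,\ srs=r^{n-1}\rangle$ is the dihedral group of order $2n$. The unitary representation $\kappa:D_{2n}\to GL(n,\mathbb{C})$ acts on $\mathbb{C}^n$, whose coordinates are indexed by $\mathbb{Z}_n=\{0,1,\dots,n-1\}$, by $(\kappa(r)v)(j)=v((j-1)\bmod n)$ and $(\kappa(s)v)(j)=v((n-j)\bmod n)$. Two unitary representations $\alpha,\alpha'$ of a group $G$ on $\mathbf{H}_\alpha,\mathbf{H}_{\alpha'}$ are (unitarily) equivalent if there is a unitary map $U:\mathbf{H}_\alpha\to\mathbf{H}_{\alpha'}$ with $U\alpha(x)U^{-1}=\alpha'(x)$ for all $x\in G$. Haar property: for a representation $\alpha$ of $G$ on a $d$-dimensional space $\mathbf{H}_\alpha$ and $v\in\mathbf{H}_\alpha$, the orbit $\alpha(G)v$ is regarded as the family $(\alpha(x)v)_{x\in G}$ indexed by the group elements. It has the Haar property if $\mathrm{card}(G)\ge d$ and for every subset $K\subseteq G$ of cardinality $d$, the vectors $(\alpha(x)v)_{x\in K}$ form a basis of $\mathbf{H}_\alpha$. Equivalently, for $G=D_{2n}=\{x_1,\dots,x_{2n}\}$, every minor of order $d$ of the $2n\times d$ matrix whose $i$-th row is the coordinate vector of $\alpha(x_i)v$ is nonzero. A frame in a finite-dimensional Hilbert space is a finite family $(u_k)_{k\in I}$ for which there are constants $a,b>0$ with $a\|u\|^2\le\sum_{k\in I}|\langle u,u_k\rangle|^2\le b\|u\|^2$ for all $u$ (equivalently, a spanning family). A frame of $m$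 vectors in an $n$-dimensional space is maximally robust to erasures if the removal of any $l\le m-n$ vectors from it leaves a frame. Zariski open refers to the Zariski topology on $\mathbf{H}_\alpha$ identified with $\mathbb{C}^n$ via a choice of basis. *)

theory Defs
  imports
    Complex_Main
    "HOL-Algebra.Group"
    "HOL-Computational_Algebra.Primes"
    "HOL-Library.Function_Algebras"
begin

text \<open>The space is a subspace \<^term>\<open>vecs V\<close> of an ambient complex vector space, so that its
  dimension can depend on a natural number. Completeness is automatic in finite dimension. The inner
  product is linear in the first argument.\<close>

record 'h ip_space =
  vecs :: "'h set"
  scl :: "complex \<Rightarrow> 'h \<Rightarrow> 'h"
  ip :: "'h \<Rightarrow> 'h \<Rightarrow> complex"

definition hilbert_space :: "'h::ab_group_add ip_space \<Rightarrow> bool" where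
  "hilbert_space V \<longleftrightarrow>
     vector_space (scl V) \<and>
     module.subspace (scl V) (vecs V) \<and>
     (\<exists>B. finite B \<and> module.span (scl V) B = vecs V) \<and>
     (\<forall>u\<in>vecs V. \<forall>v\<in>vecs V. \<forall>w\<in>vecs V. ip V (u + v) w = ip V u w + ip V v w) \<and>
     (\<forall>c. \<forall>u\<in>vecs V. \<forall>v\<in>vecs V. ip V (scl V c u) v = c * ip V u v) \<and>
     (\<forall>u\<in>vecs V. \<forall>v\<in>vecs V. ip V v u = cnj (ip V u v)) \<and>
     (\<forall>u\<in>vecs V. u \<noteq> 0 \<longrightarrow> Re (ip V u u) > 0)"

definition hdim :: "'h::ab_group_add ip_space \<Rightarrow> nat" where
  "hdim V = vector_space.dim (scl V) (vecs V)"

definition basis_family :: "'h::ab_group_add ip_space \<Rightarrow> 'i set \<Rightarrow> ('i \<Rightarrow> 'h) \<Rightarrow> bool" where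
  "basis_family V I b \<longleftrightarrow>
     inj_on b I \<and> \<not> module.dependent (scl V) (b ` I) \<and> module.span (scl V) (b ` I) = vecs V"

definition Cn :: "nat \<Rightarrow> (nat \<Rightarrow> complex) ip_space" where
  "Cn n = \<lparr> vecs = {v. \<forall>j\<ge>n. v j = 0},
            scl = (\<lambda>c v j. c * v j),
            ip = (\<lambda>u v. \<Sum>j<n. u j * cnj (v j)) \<rparr>"

definition unitary_map ::
  "'h::ab_group_add ip_space \<Rightarrow> 'k::ab_group_add ip_space \<Rightarrow> ('h \<Rightarrow> 'k) \<Rightarrow> bool" where
  "unitary_map V W U \<longleftrightarrow>
     bij_betw U (vecs V) (vecs W) \<and>
     (\<forall>u\<in>vecs V. \<forall>v\<in>vecs V. U (u + v) = U u + U v) \<and>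
     (\<forall>c. \<forall>u\<in>vecs V. U (scl V c u) = scl W c (U u)) \<and>
     (\<forall>u\<in>vecs V. \<forall>v\<in>vecs V. ip W (U u) (U v) = ip V u v)"

definition unitary_rep ::
  "('g, 'm) monoid_scheme \<Rightarrow> 'h::ab_group_add ip_space \<Rightarrow> ('g \<Rightarrow> 'h \<Rightarrow> 'h) \<Rightarrow> bool" where
  "unitary_rep G V \<alpha> \<longleftrightarrow>
     (\<forall>x\<in>carrier G. unitary_map V V (\<alpha> x)) \<and>
     (\<forall>v\<in>vecs V. \<alpha> \<one>\<^bsub>G\<^esub> v = v) \<and>
     (\<forall>x\<in>carrier G. \<forall>y\<in>carrier G. \<forall>v\<in>vecs V. \<alpha> (x \<otimes>\<^bsub>G\<^esub> y) v = \<alpha> x (\<alpha> y v))"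

definition unitarily_equivalent ::
  "('g, 'm) monoid_scheme \<Rightarrow> 'h::ab_group_add ip_space \<Rightarrow> ('g \<Rightarrow> 'h \<Rightarrow> 'h) \<Rightarrow>
   'k::ab_group_add ip_space \<Rightarrow> ('g \<Rightarrow> 'k \<Rightarrow> 'k) \<Rightarrow> bool" where
  "unitarily_equivalent G V \<alpha> W \<beta> \<longleftrightarrow>
     (\<exists>U. unitary_map V W U \<and> (\<forall>x\<in>carrier G. \<forall>v\<in>vecs V. U (\<alpha> x v) = \<beta> x (U v)))"

text \<open>The pair \<open>(i, b)\<close> is the normal form of \<open>r\<^sup>i s\<^sup>b\<close>; the product uses \<open>s r\<^sup>j = r\<^sup>n\<^sup>-\<^sup>j s\<close>.
  The lemmas below show that this is the group of order \<open>2 n\<close> with the presentation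
  \<open>r\<^sup>n = s\<^sup>2 = e\<close>, \<open>s r s = r\<^sup>n\<^sup>-\<^sup>1\<close>.\<close>

definition dihedral :: "nat \<Rightarrow> (nat \<times> bool) monoid" where
  "dihedral n = \<lparr> carrier = {..<n} \<times> UNIV,
                  monoid.mult = (\<lambda>(i, a) (j, b). ((i + (if a then n - j else j)) mod n, a \<noteq> b)),
                  one = (0, False) \<rparr>"

definition dih_r :: "nat \<times> bool" where "dih_r = (1, False)"
definition dih_s :: "nat \<times> bool" where "dih_s = (0, True)"

definition kappa_r :: "nat \<Rightarrow> (nat \<Rightarrow> complex) \<Rightarrow> nat \<Rightarrow> complex" where
  "kappa_r n v = (\<lambda>j. if j < n then v ((j + n - 1) mod n) else 0)"

definition kappa_s :: "nat \<Rightarrow> (nat \<Rightarrow> complex) \<Rightarrow> nat \<Rightarrow> complex" where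
  "kappa_s n v = (\<lambda>j. if j < n then v ((n - j) mod n) else 0)"

fun kappa :: "nat \<Rightarrow> nat \<times> bool \<Rightarrow> (nat \<Rightarrow> complex) \<Rightarrow> nat \<Rightarrow> complex" where
  "kappa n (i, b) v = (kappa_r n ^^ i) (if b then kappa_s n v else v)"

text \<open>Meaningful for finite \<open>G\<close>: \<^const>\<open>card\<close> of an infinite set is \<open>0\<close>.\<close>

definition haar_property ::
  "('g, 'm) monoid_scheme \<Rightarrow> 'h::ab_group_add ip_space \<Rightarrow> ('g \<Rightarrow> 'h \<Rightarrow> 'h) \<Rightarrow> 'h \<Rightarrow> bool" where
  "haar_property G V \<alpha> v \<longleftrightarrow>
     hdim V \<le> card (carrier G) \<and>
     (\<forall>K\<subseteq>carrier G. card K = hdim V \<longrightarrow> basis_family V K (\<lambda>x. \<alpha> x v))"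

definition is_frame :: "'h::ab_group_add ip_space \<Rightarrow> 'i set \<Rightarrow> ('i \<Rightarrow> 'h) \<Rightarrow> bool" where
  "is_frame V I f \<longleftrightarrow>
     finite I \<and> (\<forall>k\<in>I. f k \<in> vecs V) \<and>
     (\<exists>a b :: real. a > 0 \<and> b > 0 \<and>
        (\<forall>u\<in>vecs V. a * Re (ip V u u) \<le> (\<Sum>k\<in>I. (cmod (ip V u (f k)))\<^sup>2) \<and>
                    (\<Sum>k\<in>I. (cmod (ip V u (f k)))\<^sup>2) \<le> b * Re (ip V u u)))"

definition max_robust_frame :: "'h::ab_group_add ip_space \<Rightarrow> 'i set \<Rightarrow> ('i \<Rightarrow> 'h) \<Rightarrow> bool" where
  "max_robust_frame V I f \<longleftrightarrow>
     is_frame V I f \<and>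
     (\<forall>L\<subseteq>I. card L + hdim V \<le> card I \<longrightarrow> is_frame V (I - L) f)"

inductive_set polynomial_fun :: "nat \<Rightarrow> ((nat \<Rightarrow> complex) \<Rightarrow> complex) set" for n :: nat where
  const: "(\<lambda>_. a) \<in> polynomial_fun n"
| coord: "j < n \<Longrightarrow> (\<lambda>c. c j) \<in> polynomial_fun n"
| add: "p \<in> polynomial_fun n \<Longrightarrow> q \<in> polynomial_fun n \<Longrightarrow> (\<lambda>c. p c + q c) \<in> polynomial_fun n"
| mult: "p \<in> polynomial_fun n \<Longrightarrow> q \<in> polynomial_fun n \<Longrightarrow> (\<lambda>c. p c * q c) \<in> polynomial_fun n"

definition zariski_closed_Cn :: "nat \<Rightarrow> (nat \<Rightarrow> complex) set \<Rightarrow> bool" where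
  "zariski_closed_Cn n Z \<longleftrightarrow>
     (\<exists>P\<subseteq>polynomial_fun n. Z = {c \<in> vecs (Cn n). \<forall>p\<in>P. p c = 0})"

definition from_coords :: "'h::ab_group_add ip_space \<Rightarrow> (nat \<Rightarrow> 'h) \<Rightarrow> (nat \<Rightarrow> complex) \<Rightarrow> 'h" where
  "from_coords V b c = (\<Sum>j<hdim V. scl V (c j) (b j))"

text \<open>The choice of basis is immaterial, see \<open>zariski_open_iff\<close> below.\<close>

definition zariski_open :: "'h::ab_group_add ip_space \<Rightarrow> 'h set \<Rightarrow> bool" where
  "zariski_open V E \<longleftrightarrow>
     E \<subseteq> vecs V \<and>
     (\<exists>b. basis_family V {..<hdim V} b \<and>
          zariski_closed_Cn (hdim V) {c \<in> vecs (Cn (hdim V)). from_coords V b c \<notin> E})"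

lemma dihedral_simps:
  "carrier (dihedral n) = {..<n} \<times> UNIV"
  "(i, a) \<otimes>\<^bsub>dihedral n\<^esub> (j, b) = ((i + (if a then n - j else j)) mod n, a \<noteq> b)"
  "\<one>\<^bsub>dihedral n\<^esub> = (0, False)"
  by (simp_all add: dihedral_def)

lemma dihedral_int:
  assumes "j < n"
  shows "int ((i + (if a then n - j else j)) mod n) = (int i + (if a then - int j else int j)) mod int n"
proof -
  have "(int i + (int n - int j)) mod int n = (int i - int j + int n) mod int n" 
    by (simp add: algebra_simps)
  then show ?thesis using assms by (simp add: of_nat_mod of_nat_diff)
qed

lemma dihedral_group: assumes "n > 0" shows "group (dihedral n)"
proof (rule groupI)
  fix x y z assume A: "x \<in> carrier (dihedral n)" "y \<in> carrier (dihedral n)" "z \<in> carrier (dihedral n)"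
  obtain i a j b k c where e: "x = (i,a)" "y = (j,b)" "z = (k,c)" by (metis prod.exhaust)
  have l: "i < n" "j < n" "k < n" using A by (auto simp: e dihedral_simps)
  have ll: "(j + (if b then n - k else k)) mod n < n" using assms by simp
  have "int (fst (x \<otimes>\<^bsub>dihedral n\<^esub> y \<otimes>\<^bsub>dihedral n\<^esub> z)) = int (fst (x \<otimes>\<^bsub>dihedral n\<^esub> (y \<otimes>\<^bsub>dihedral n\<^esub> z)))"
    unfolding e dihedral_simps fst_conv dihedral_int[OF l(3)] dihedral_int[OF ll] dihedral_int[OF l(2)]
    by (cases a; cases b) (simp_all add: mod_simps algebra_simps)
  then show "x \<otimes>\<^bsub>dihedral n\<^esub> y \<otimes>\<^bsub>dihedral n\<^esub> z = x \<otimes>\<^bsub>dihedral n\<^esub> (y \<otimes>\<^bsub>dihedral n\<^esub> z)"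
    by (auto simp: e dihedral_simps)
next
  fix x assume A: "x \<in> carrier (dihedral n)"
  obtain i a where e: "x = (i,a)" by fastforce
  show "\<exists>y\<in>carrier (dihedral n). y \<otimes>\<^bsub>dihedral n\<^esub> x = \<one>\<^bsub>dihedral n\<^esub>"
  proof (cases a)
    case True
    then show ?thesis using A by (intro bexI[of _ x]) (auto simp: e dihedral_simps)
  next
    case False
    have "((n - i) mod n + i) mod n = 0" using A by (auto simp: e dihedral_simps mod_simps)
    with False show ?thesis using A assms 
      by (intro bexI[of _ "((n - i) mod n, False)"]) (auto simp: e dihedral_simps)
  qed
qed (use assms in \<open>auto simp: dihedral_simps\<close>)

lemma dihedral_order: "card (carrier (dihedral n)) = 2 * n"
  by (simp add: dihedral_simps card_cartesian_product)

lemma dih_in_carrier: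
  assumes "n > 1" shows "dih_r \<in> carrier (dihedral n)" "dih_s \<in> carrier (dihedral n)"
  using assms by (auto simp: dihedral_simps dih_r_def dih_s_def)

lemma dih_r_pow: assumes "n > 1" shows "dih_r [^]\<^bsub>dihedral n\<^esub> (i::nat) = (i mod n, False)"
proof -
  interpret group "dihedral n" using dihedral_group assms by simp
  show ?thesis
    by (induction i) (use assms in \<open>auto simp: dihedral_simps dih_r_def mod_simps\<close>)
qed

lemma dihedral_normal_form:
  assumes "n > 1" "i < n"
  shows "(i, b) = dih_r [^]\<^bsub>dihedral n\<^esub> i \<otimes>\<^bsub>dihedral n\<^esub> (if b then dih_s else \<one>\<^bsub>dihedral n\<^esub>)"
  unfolding dih_r_pow[OF assms(1)] using assms by (auto simp: dihedral_simps dih_s_def)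

lemma dihedral_relations:
  assumes "n > 1"
  shows "dih_r [^]\<^bsub>dihedral n\<^esub> n = \<one>\<^bsub>dihedral n\<^esub>"
    "dih_s [^]\<^bsub>dihedral n\<^esub> (2::nat) = \<one>\<^bsub>dihedral n\<^esub>"
    "dih_s \<otimes>\<^bsub>dihedral n\<^esub> dih_r \<otimes>\<^bsub>dihedral n\<^esub> dih_s = dih_r [^]\<^bsub>dihedral n\<^esub> (n - 1)"
proof -
  interpret group "dihedral n" using dihedral_group assms by simp
  show "dih_r [^]\<^bsub>dihedral n\<^esub> n = \<one>\<^bsub>dihedral n\<^esub>"
    unfolding dih_r_pow[OF assms] by (simp add: dihedral_simps)
  show "dih_s [^]\<^bsub>dihedral n\<^esub> (2::nat) = \<one>\<^bsub>dihedral n\<^esub>"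
    using dih_in_carrier[OF assms] by (simp add: numeral_2_eq_2) (simp add: dih_s_def dihedral_simps)
  show "dih_s \<otimes>\<^bsub>dihedral n\<^esub> dih_r \<otimes>\<^bsub>dihedral n\<^esub> dih_s = dih_r [^]\<^bsub>dihedral n\<^esub> (n - 1)"
    unfolding dih_r_pow[OF assms] using assms by (simp add: dih_s_def dih_r_def dihedral_simps le_mod_geq)
qed

text \<open>Universal property of the presentation (uniqueness is \<open>dihedral_normal_form\<close>).\<close>

lemma dihedral_universal:
  fixes H (structure)
  assumes "group H" "n > 1" and ab: "a \<in> carrier H" "b \<in> carrier H"
    and rel: "a [^] n = \<one>" "b [^] (2::nat) = \<one>" "b \<otimes> a \<otimes> b = a [^] (n - 1)"
  shows "\<exists>h\<in>hom (dihedral n) H. h dih_r = a \<and> h dih_s = b"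
proof -
  interpret group H by fact
  define h where "h = (\<lambda>(i::nat, t). a [^] i \<otimes> (if t then b else \<one>))"
  have bb: "b \<otimes> b = \<one>" using rel(2) ab by (simp add: numeral_2_eq_2)
  have md: "a [^] (m mod n) = a [^] m" for m :: nat
  proof -
    have "a [^] m = a [^] (n * (m div n) + m mod n)" by simp
    also have "\<dots> = (a [^] n) [^] (m div n) \<otimes> a [^] (m mod n)"
      using ab by (simp only: nat_pow_mult nat_pow_pow)
    also have "\<dots> = a [^] (m mod n)" using ab rel(1) by simp
    finally show ?thesis by simp
  qed
  have an: "a [^] (n - 1) = inv a"
  proof (rule inv_equality[symmetric])
    have "a [^] (n - 1) \<otimes> a = a [^] Suc (n - 1)" by simp
    then show "a [^] (n - 1) \<otimes> a = \<one>" using rel(1) assms(2) by simp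
  qed (use ab in auto)
  have ba1: "b \<otimes> a = inv a \<otimes> b"
  proof -
    have "b \<otimes> a = b \<otimes> a \<otimes> b \<otimes> b" using ab bb by (simp add: m_assoc)
    then show ?thesis using rel(3) an by simp
  qed
  have ba: "b \<otimes> a [^] j = inv (a [^] j) \<otimes> b" for j :: nat
  proof (induction j)
    case (Suc j)
    have "b \<otimes> a [^] Suc j = (b \<otimes> a [^] j) \<otimes> a" using ab by (simp add: m_assoc)
    also have "\<dots> = inv (a [^] j) \<otimes> (b \<otimes> a)" using ab by (simp add: Suc m_assoc)
    also have "\<dots> = inv (a [^] j) \<otimes> inv a \<otimes> b" using ab by (simp add: ba1 m_assoc)
    also have "inv (a [^] j) \<otimes> inv a = inv (a \<otimes> a [^] j)" using ab by (simp add: inv_mult_group)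
    also have "a \<otimes> a [^] j = a [^] Suc j" using ab by (simp add: nat_pow_Suc2[symmetric])
    finally show ?case .
  qed (use ab in simp)
  have sub: "a [^] (n - j) = inv (a [^] j)" if "j < n" for j
  proof (rule inv_equality[symmetric])
    show "a [^] (n - j) \<otimes> a [^] j = \<one>" using that ab rel(1) by (simp add: nat_pow_mult)
  qed (use ab in auto)
  have "h \<in> hom (dihedral n) H"
  proof (rule homI)
    show "h x \<in> carrier H" for x using ab by (cases x) (auto simp: h_def)
    fix x y assume "x \<in> carrier (dihedral n)" "y \<in> carrier (dihedral n)"
    then obtain i s j t where e: "x = (i,s)" "y = (j,t)" "i < n" "j < n" by (auto simp: dihedral_simps)
    have cc: "b \<otimes> (a [^] j \<otimes> c) = inv (a [^] j) \<otimes> (b \<otimes> c)" if "c \<in> carrier H" for c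
      using ba[of j] ab that by (simp add: m_assoc[symmetric])
    show "h (x \<otimes>\<^bsub>dihedral n\<^esub> y) = h x \<otimes> h y"
      using ab e(4) unfolding e h_def dihedral_simps
      by (auto simp: md nat_pow_mult[symmetric] sub m_assoc cc bb ba)
  qed
  moreover have "h dih_r = a" "h dih_s = b" using ab by (simp_all add: h_def dih_r_def dih_s_def)
  ultimately show ?thesis by blast
qed

lemma vecs_Cn: "vecs (Cn n) = {v. \<forall>j\<ge>n. v j = 0}"
  and scl_Cn: "scl (Cn n) = (\<lambda>c v j. c * v j)"
  and ip_Cn: "ip (Cn n) = (\<lambda>u v. \<Sum>j<n. u j * cnj (v j))"
  by (simp_all add: Cn_def)

lemma Cn_vector_space: "vector_space (scl (Cn n))"
  by unfold_locales (auto simp: scl_Cn algebra_simps fun_eq_iff)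

lemma Cn_unit_basis: "basis_family (Cn n) {..<n} (\<lambda>j i. if i = j then 1 else 0)"
proof -
  interpret vector_space "scl (Cn n)" by (rule Cn_vector_space)
  let ?e = "(\<lambda>j i. if i = j then 1 else 0) :: nat \<Rightarrow> nat \<Rightarrow> complex"
  have inj: "inj_on ?e {..<n}"
    by (auto simp: inj_on_def fun_eq_iff split: if_splits)
  have sum_e: "(\<Sum>v\<in>?e ` {..<n}. scl (Cn n) (u v) v) = (\<lambda>i. if i < n then u (?e i) else 0)" for u
  proof -
    have sa: "(\<Sum>j\<in>A. f j) i = (\<Sum>j\<in>A. f j i)" for A :: "nat set" and f :: "nat \<Rightarrow> nat \<Rightarrow> complex" and i
      by (induction A rule: infinite_finite_induct) auto
    have "(\<Sum>v\<in>?e ` {..<n}. scl (Cn n) (u v) v) = (\<Sum>j<n. scl (Cn n) (u (?e j)) (?e j))"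
      using inj by (simp add: sum.reindex)
    also have "\<dots> = (\<lambda>i. if i < n then u (?e i) else 0)"
      by (rule ext, unfold sa) (simp add: scl_Cn if_distrib cong: if_cong)
    finally show ?thesis .
  qed
  have "\<not> dependent (?e ` {..<n})"
    unfolding dependent_finite[OF finite_imageI[OF finite_lessThan]] sum_e
    by (auto simp: fun_eq_iff)
  moreover have "span (?e ` {..<n}) = vecs (Cn n)"
  proof -
    have "v \<in> range (\<lambda>u i. if i < n then u (?e i) else 0)" if "v \<in> vecs (Cn n)" for v
    proof (rule image_eqI)
      show "v = (\<lambda>i. if i < n then (\<lambda>w. v (inv_into {..<n} ?e w)) (?e i) else 0)"
        using that inv_into_f_f[OF inj] by (auto simp: vecs_Cn fun_eq_iff)
    qed simp
    then show ?thesis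
      unfolding span_finite[OF finite_imageI[OF finite_lessThan]] sum_e
      by (auto simp: vecs_Cn)
  qed
  ultimately show ?thesis using inj by (simp add: basis_family_def)
qed

lemma basis_family_hdim:
  assumes "vector_space (scl V)" "basis_family V I b"
  shows "hdim V = card I"
proof -
  interpret vector_space "scl V" by fact
  have "dim (vecs V) = card (b ` I)"
    using assms(2) unfolding basis_family_def by (intro dim_eq_card) (metis span_span, simp)
  then show ?thesis using assms(2) by (simp add: hdim_def basis_family_def card_image)
qed

lemma hdim_Cn: "hdim (Cn n) = n"
  using basis_family_hdim[OF Cn_vector_space Cn_unit_basis] by simp

lemma Cn_hilbert: "hilbert_space (Cn n)"
proof -
  interpret vector_space "scl (Cn n)" by (rule Cn_vector_space)
  have pos: "Re (ip (Cn n) u u) > 0" if u: "u \<in> vecs (Cn n)" "u \<noteq> 0" for u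
  proof -
    obtain j where "u j \<noteq> 0" using u(2) by (auto simp: fun_eq_iff)
    moreover from this have "j < n" using u(1) unfolding vecs_Cn by (metis (mono_tags) mem_Collect_eq not_le)
    ultimately have "(\<Sum>j<n. (cmod (u j))\<^sup>2) > 0" by (intro sum_pos2[of _ j]) auto
    moreover have "Re (ip (Cn n) u u) = (\<Sum>j<n. (cmod (u j))\<^sup>2)"
      by (simp add: ip_Cn cmod_power2 flip: power2_eq_square)
    ultimately show ?thesis by simp
  qed
  have "subspace (vecs (Cn n))"
    unfolding subspace_def by (auto simp: vecs_Cn scl_Cn)
  moreover have "\<exists>B. finite B \<and> span B = vecs (Cn n)"
    using Cn_unit_basis unfolding basis_family_def by blast
  ultimately show ?thesis
    using Cn_vector_space pos unfolding hilbert_space_def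
    by (simp only: simp_thms) (auto simp: ip_Cn scl_Cn algebra_simps sum.distrib sum_distrib_left)
qed

lemma kappa_gens: "kappa n dih_r = kappa_r n" "kappa n dih_s = kappa_s n"
  by (auto simp: dih_r_def dih_s_def)

lemma kappa_eq:
  assumes "v \<in> vecs (Cn n)" "i < n"
  shows "kappa n (i, b) v =
    (\<lambda>j. if j < n then v (nat ((if b then int i - int j else int j - int i) mod int n)) else 0)"
proof -
  have n: "n > 0" using assms by simp
  have r: "(kappa_r n ^^ k) w = (\<lambda>j. if j < n then w (nat ((int j - int k) mod int n)) else 0)"
    if "w \<in> vecs (Cn n)" for k w
  proof (induction k)
    case 0
    then show ?case using that by (auto simp: vecs_Cn fun_eq_iff)
  next
    case (Suc k)
    have *: "int ((j + n - Suc 0) mod n) = (int j - 1) mod int n" for j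
    proof -
      have "int ((j + n - Suc 0) mod n) = (int j - 1 + int n) mod int n"
        using n by (simp add: of_nat_mod of_nat_diff algebra_simps)
      then show ?thesis by simp
    qed
    have kr: "(kappa_r n ^^ Suc k) w = kappa_r n (\<lambda>j. if j < n then w (nat ((int j - int k) mod int n)) else 0)"
      by (simp add: Suc)
    show ?case unfolding kr using n
      by (auto simp: kappa_r_def fun_eq_iff * mod_simps algebra_simps)
  qed
  have s: "int ((n - j) mod n) = (- int j) mod int n" if "j < n" for j
  proof -
    have "int ((n - j) mod n) = (- int j + int n) mod int n"
      using that by (simp add: of_nat_mod of_nat_diff)
    then show ?thesis by simp
  qed
  have sv: "kappa_s n v \<in> vecs (Cn n)" by (simp add: vecs_Cn kappa_s_def)
  have s': "kappa_s n v k = v (nat ((- int k) mod int n))" if "k < n" for k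
    using that s[OF that] by (simp add: kappa_s_def) (metis nat_int)
  have lt: "nat (x mod int n) < n" for x using n by (simp add: nat_less_iff)
  show ?thesis
    using assms n lt by (cases b) (auto simp: r sv r[OF sv] s' fun_eq_iff mod_simps)
qed

lemma kappa_unitary_rep:
  assumes "n > 0"
  shows "unitary_rep (dihedral n) (Cn n) (kappa n)"
proof -
  have lt: "nat (x mod int n) < n" for x using assms by (simp add: nat_less_iff)
  have nm: "int (nat (x mod int n)) = x mod int n" for x using assms by simp
  have in_vecs: "kappa n x v \<in> vecs (Cn n)" if "x \<in> carrier (dihedral n)" "v \<in> vecs (Cn n)" for x v
    using that by (cases x) (auto simp: dihedral_simps kappa_eq vecs_Cn simp del: kappa.simps)
  have one: "kappa n \<one>\<^bsub>dihedral n\<^esub> v = v" if "v \<in> vecs (Cn n)" for v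
    by (simp add: dihedral_simps)
  have mult: "kappa n (x \<otimes>\<^bsub>dihedral n\<^esub> y) v = kappa n x (kappa n y v)"
    if xy: "x \<in> carrier (dihedral n)" "y \<in> carrier (dihedral n)" and v: "v \<in> vecs (Cn n)" for x y v
  proof -
    obtain i a j b where e: "x = (i,a)" "y = (j,b)" "i < n" "j < n"
      using xy by (auto simp: dihedral_simps)
    have w: "kappa n (j, b) v \<in> vecs (Cn n)" using in_vecs xy v e by blast
    have l: "(i + (if a then n - j else j)) mod n < n" using assms by simp
    show ?thesis
      unfolding e dihedral_simps kappa_eq[OF w e(3)]
      unfolding kappa_eq[OF v e(4)] kappa_eq[OF v l] dihedral_int[OF e(4)]
      by (cases a; cases b) (auto simp: fun_eq_iff lt nm mod_simps algebra_simps)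
  qed
  have un: "unitary_map (Cn n) (Cn n) (kappa n x)" if x: "x \<in> carrier (dihedral n)" for x
  proof -
    interpret group "dihedral n" using assms by (rule dihedral_group)
    have bij: "bij_betw (kappa n x) (vecs (Cn n)) (vecs (Cn n))"
    proof (rule bij_betwI)
      let ?y = "inv\<^bsub>dihedral n\<^esub> x"
      show "kappa n x \<in> vecs (Cn n) \<rightarrow> vecs (Cn n)" using in_vecs x by blast
      show "kappa n ?y \<in> vecs (Cn n) \<rightarrow> vecs (Cn n)" using in_vecs x by blast
      show "kappa n ?y (kappa n x v) = v" if "v \<in> vecs (Cn n)" for v
        using mult[of ?y x v] x that one by simp
      show "kappa n x (kappa n ?y v) = v" if "v \<in> vecs (Cn n)" for v
        using mult[of x ?y v] x that one by simp
    qed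
    obtain i b where e: "x = (i, b)" "i < n" using x by (auto simp: dihedral_simps)
    define \<sigma> where "\<sigma> j = nat ((if b then int i - int j else int j - int i) mod int n)" for j
    have k: "kappa n x v = (\<lambda>j. if j < n then v (\<sigma> j) else 0)" if "v \<in> vecs (Cn n)" for v
      using kappa_eq[OF that e(2), of b] by (simp only: e \<sigma>_def)
    define \<tau> where "\<tau> j = nat ((if b then int i - int j else int j + int i) mod int n)" for j
    have st: "\<tau> (\<sigma> j) = j" "\<sigma> (\<tau> j) = j" if "j < n" for j
      using that by (auto simp: \<sigma>_def \<tau>_def nm mod_simps)
    have \<sigma>: "bij_betw \<sigma> {..<n} {..<n}"
      by (rule bij_betwI[where g = \<tau>]) (auto simp: st lt, auto simp: \<sigma>_def \<tau>_def lt)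
    have add: "u + v \<in> vecs (Cn n)" "scl (Cn n) c u \<in> vecs (Cn n)"
      if "u \<in> vecs (Cn n)" "v \<in> vecs (Cn n)" for u v c
      using that by (auto simp: vecs_Cn scl_Cn)
    have "ip (Cn n) (kappa n x u) (kappa n x v) = ip (Cn n) u v"
      if "u \<in> vecs (Cn n)" "v \<in> vecs (Cn n)" for u v
      using sum.reindex_bij_betw[OF \<sigma>, of "\<lambda>j. u j * cnj (v j)"] that by (simp add: k ip_Cn)
    moreover have "kappa n x (u + v) = kappa n x u + kappa n x v"
      if "u \<in> vecs (Cn n)" "v \<in> vecs (Cn n)" for u v
      unfolding k[OF add(1)[OF that]] k[OF that(1)] k[OF that(2)] by (simp add: fun_eq_iff)
    moreover have "kappa n x (scl (Cn n) c u) = scl (Cn n) c (kappa n x u)"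
      if "u \<in> vecs (Cn n)" for c u
      unfolding k[OF add(2)[OF that that]] k[OF that] by (simp add: fun_eq_iff scl_Cn)
    ultimately show ?thesis using bij unfolding unitary_map_def by blast
  qed
  show ?thesis using un one mult by (simp add: unitary_rep_def)
qed

lemma polynomial_fun_linear:
  "finite J \<Longrightarrow> (\<And>j. j \<in> J \<Longrightarrow> j < n) \<Longrightarrow> (\<lambda>c. \<Sum>j\<in>J. a j * c j) \<in> polynomial_fun n"
proof (induction J rule: finite_induct)
  case empty
  then show ?case by (simp add: polynomial_fun.const)
next
  case (insert k J)
  then show ?case
    by (auto intro!: polynomial_fun.intros)
qed

lemma polynomial_fun_compose:
  assumes "p \<in> polynomial_fun n"
  shows "(\<lambda>c. p (\<lambda>i. if i < n then \<Sum>j<n. A i j * c j else 0)) \<in> polynomial_fun n"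
  using assms
proof induction
  case (coord j)
  then show ?case by (simp, intro polynomial_fun_linear) auto
qed (auto intro: polynomial_fun.intros)

lemma zariski_closed_change_basis:
  assumes V: "vector_space (scl V)"
    and b: "basis_family V {..<hdim V} b" and b': "basis_family V {..<hdim V} b'"
    and closed: "zariski_closed_Cn (hdim V) {c \<in> vecs (Cn (hdim V)). from_coords V b c \<notin> E}"
  shows "zariski_closed_Cn (hdim V) {c \<in> vecs (Cn (hdim V)). from_coords V b' c \<notin> E}"
proof -
  interpret vector_space "scl V" by fact
  define n where "n = hdim V"
  have "\<exists>a. b' j = (\<Sum>i<n. scl V (a i) (b i))" if "j < n" for j
  proof -
    have "b' j \<in> span (b' ` {..<n})" using that by (intro span_base) auto
    then have "b' j \<in> span (b ` {..<n})" using b b' by (simp add: basis_family_def n_def)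
    then obtain u where "b' j = (\<Sum>v\<in>b ` {..<n}. scl V (u v) v)"
      unfolding span_finite[OF finite_imageI[OF finite_lessThan]] by auto
    also have "\<dots> = (\<Sum>i<n. scl V (u (b i)) (b i))"
      using b by (simp add: basis_family_def n_def sum.reindex)
    finally show ?thesis by (intro exI)
  qed
  then obtain a where a: "\<And>j. j < n \<Longrightarrow> b' j = (\<Sum>i<n. scl V (a j i) (b i))" by metis
  define T where "T c = (\<lambda>i. if i < n then \<Sum>j<n. a j i * c j else 0)" for c :: "nat \<Rightarrow> complex"
  have T: "from_coords V b' c = from_coords V b (T c)" for c
  proof -
    have "from_coords V b' c = (\<Sum>j<n. \<Sum>i<n. scl V (a j i * c j) (b i))"
      by (simp add: from_coords_def n_def[symmetric] a scale_sum_right mult.commute)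
    also have "\<dots> = (\<Sum>i<n. scl V (\<Sum>j<n. a j i * c j) (b i))"
      by (subst sum.swap) (simp add: scale_sum_left)
    finally show ?thesis by (simp add: from_coords_def n_def[symmetric] T_def)
  qed
  obtain P where P: "P \<subseteq> polynomial_fun n"
    "{c \<in> vecs (Cn n). from_coords V b c \<notin> E} = {c \<in> vecs (Cn n). \<forall>p\<in>P. p c = 0}"
    using closed by (auto simp: zariski_closed_Cn_def n_def)
  have Tv: "T c \<in> vecs (Cn n)" for c by (simp add: vecs_Cn T_def)
  have "from_coords V b' c \<notin> E \<longleftrightarrow> (\<forall>p\<in>P. p (T c) = 0)" for c
    using P(2) Tv[of c] unfolding T by blast
  moreover have "(\<lambda>p c. p (T c)) ` P \<subseteq> polynomial_fun n"
    using P(1) polynomial_fun_compose[where A = "\<lambda>i j. a j i"] unfolding T_def by blast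
  ultimately show ?thesis
    unfolding zariski_closed_Cn_def n_def[symmetric] by (intro exI[of _ "(\<lambda>p c. p (T c)) ` P"]) auto
qed

lemma zariski_open_iff:
  assumes "vector_space (scl V)" "basis_family V {..<hdim V} b"
  shows "zariski_open V E \<longleftrightarrow> E \<subseteq> vecs V \<and>
    zariski_closed_Cn (hdim V) {c \<in> vecs (Cn (hdim V)). from_coords V b c \<notin> E}"
  using assms zariski_closed_change_basis unfolding zariski_open_def by blast

end

theory Submission
  imports Defs "Jordan_Normal_Form.Determinant"
begin

text \<open>
  Transporting along the unitary equivalence, everything is about the vectors \<open>\<kappa>(x) c\<close> in \<open>\<complex>\<^sup>n\<close>,
  whose coordinates are the coordinates of \<open>c\<close>, rotated or reflected.

  For even \<open>n\<close> the constant vector and \<open>\<chi>(j) = (-1)\<^sup>j\<close> are both preserved by all rotations and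
  reflections \<open>r\<^sup>i s\<^sup>b\<close> with \<open>i\<close> even. There are exactly \<open>n\<close> of those, and the corresponding orbit
  vectors have the same pairing with \<open>1\<close> and the same pairing with \<open>\<chi>\<close>; so a suitable combination
  of these two functionals vanishes on all of them, and they do not span.

  For prime \<open>n\<close> the main point is that for every set \<open>K\<close> of \<open>n\<close> group elements some single \<open>c\<close> makes
  the orbit vectors indexed by \<open>K\<close> independent. In Fourier coordinates the rows of the orbit matrix
  are \<open>(a\<^sub>k \<omega>\<^sup>i\<^sup>k)\<^sub>k\<close> for rotations and \<open>(a\<^sub>-\<^sub>k \<omega>\<^sup>i\<^sup>k)\<^sub>k\<close> for reflections, where \<open>a\<close> lists the Fourier
  coefficients of \<open>c\<close>. If \<open>K\<close> has \<open>q\<close> elements of the rarer kind, then \<open>2 q < n\<close> because \<open>n\<close> is odd, so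
  there are \<open>q\<close> indices \<open>1, \<dots>, q\<close> disjoint from their negatives, and letting \<open>a\<close> vanish on one of
  these two sets makes the matrix block triangular (\<open>exists_nonsingular_orbit\<close>). The diagonal
  blocks are square submatrices of the Fourier matrix, which are invertible by Chebotarev's theorem
  (\<open>chebotarev_fourier_minors\<close>). Hence each minor is a nonzero polynomial in \<open>c\<close>, and the Zariski open
  set is where the product of all these minors does not vanish.

  Chebotarev's theorem is proved by reduction modulo the prime \<open>\<omega> - 1\<close> above \<open>p\<close>. Let \<open>M\<close> be the
  \<open>\<int>[\<omega>]\<close>-module generated by the coefficients \<open>w\<^sub>j\<close> of a polynomial of degree below \<open>p\<close> that has at
  most \<open>k\<close> terms and vanishes at \<open>k\<close> distinct \<open>p\<close>-th roots of unity. Its divided differences at these points vanish,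
  and modulo \<open>\<omega> - 1\<close> all points become \<open>1\<close>, where the divided differences of \<open>t\<^sup>j\<close> are binomial
  coefficients. So \<open>\<Sum>\<^sub>j w\<^sub>j (j choose r)\<close> lies in \<open>(\<omega> - 1) M\<close> for \<open>r < k\<close>, and Lagrange interpolation
  modulo \<open>p\<close> yields \<open>w\<^sub>j \<in> (\<omega> - 1) M\<close> for each \<open>j\<close>. Thus \<open>M = (\<omega> - 1) M\<close>, hence \<open>M = p M\<close>, which
  forces \<open>M = 0\<close> as \<open>M\<close> is finitely generated and torsion free.

  Finally, the Haar property gives maximal robustness because deleting at most \<open>n\<close> of the
  \<open>2 n\<close> vectors leaves a basis among the rest, and finite spanning families are frames.
\<close>

section \<open>Modules over the cyclotomic integers\<close>

text \<open>The \<open>\<int>[\<omega>]\<close>-submodule of \<open>\<complex>\<close> generated by \<open>G\<close>; in particular \<open>G = {1}\<close> gives the ring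
  \<open>\<int>[\<omega>]\<close> itself.\<close>

inductive_set adjoin_span :: "complex \<Rightarrow> complex set \<Rightarrow> complex set" for \<omega> G where
  zero: "0 \<in> adjoin_span \<omega> G"
| gen: "g \<in> G \<Longrightarrow> g \<in> adjoin_span \<omega> G"
| add: "x \<in> adjoin_span \<omega> G \<Longrightarrow> y \<in> adjoin_span \<omega> G \<Longrightarrow> x + y \<in> adjoin_span \<omega> G"
| uminus: "x \<in> adjoin_span \<omega> G \<Longrightarrow> - x \<in> adjoin_span \<omega> G"
| root: "x \<in> adjoin_span \<omega> G \<Longrightarrow> \<omega> * x \<in> adjoin_span \<omega> G"

abbreviation adjoin_ring :: "complex \<Rightarrow> complex set" where
  "adjoin_ring \<omega> \<equiv> adjoin_span \<omega> {1}"

lemma adjoin_span_diff: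
  "x \<in> adjoin_span \<omega> G \<Longrightarrow> y \<in> adjoin_span \<omega> G \<Longrightarrow> x - y \<in> adjoin_span \<omega> G"
  using adjoin_span.add[OF _ adjoin_span.uminus, of x \<omega> G y] by simp

lemma adjoin_span_sum:
  "(\<And>i. i \<in> A \<Longrightarrow> f i \<in> adjoin_span \<omega> G) \<Longrightarrow> sum f A \<in> adjoin_span \<omega> G"
  by (induction A rule: infinite_finite_induct) (auto intro: adjoin_span.zero adjoin_span.add)

lemma adjoin_span_smult:
  assumes "r \<in> adjoin_ring \<omega>" "x \<in> adjoin_span \<omega> G"
  shows "r * x \<in> adjoin_span \<omega> G"
  using assms(1)
proof induction
  case (root y)
  then show ?case using adjoin_span.root[of "y * x"] by (simp add: mult.assoc)
qed (use assms(2) in \<open>auto simp: distrib_right intro: adjoin_span.intros\<close>)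

lemma adjoin_ring_one: "1 \<in> adjoin_ring \<omega>"
  by (rule adjoin_span.gen) simp

lemma adjoin_ring_root: "\<omega> \<in> adjoin_ring \<omega>"
  using adjoin_span.root[OF adjoin_ring_one] by simp

lemma adjoin_ring_of_nat: "of_nat k \<in> adjoin_ring \<omega>"
  by (induction k) (auto intro: adjoin_span.zero adjoin_span.add adjoin_ring_one)

lemma adjoin_ring_of_int: "of_int k \<in> adjoin_ring \<omega>"
  by (cases k rule: int_cases2) (simp_all add: adjoin_ring_of_nat adjoin_span.uminus)

lemma adjoin_ring_power: "r \<in> adjoin_ring \<omega> \<Longrightarrow> r ^ k \<in> adjoin_ring \<omega>"
  by (induction k) (auto intro: adjoin_ring_one adjoin_span_smult)

lemmas adjoin_ring_intros = adjoin_span.zero adjoin_span.add adjoin_span.uminus adjoin_span_diff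
  adjoin_span_sum adjoin_span_smult adjoin_ring_one adjoin_ring_root adjoin_ring_of_nat
  adjoin_ring_of_int adjoin_ring_power

text \<open>Congruence modulo the ideal generated by \<open>\<omega> - 1\<close> in \<open>\<int>[\<omega>]\<close>.\<close>

definition cong_root :: "complex \<Rightarrow> complex \<Rightarrow> complex \<Rightarrow> bool" where
  "cong_root \<omega> x y \<longleftrightarrow> (\<exists>r\<in>adjoin_ring \<omega>. x = y + (\<omega> - 1) * r)"

lemma cong_root_refl: "cong_root \<omega> x x"
  by (auto simp: cong_root_def intro!: bexI[of _ 0] adjoin_ring_intros)

lemma cong_root_add:
  assumes "cong_root \<omega> x x'" "cong_root \<omega> y y'" shows "cong_root \<omega> (x + y) (x' + y')"
proof -
  obtain r s where "r \<in> adjoin_ring \<omega>" "s \<in> adjoin_ring \<omega>"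
    "x = x' + (\<omega> - 1) * r" "y = y' + (\<omega> - 1) * s"
    using assms by (auto simp: cong_root_def)
  then show ?thesis unfolding cong_root_def
    by (intro bexI[of _ "r + s"]) (auto simp: algebra_simps intro: adjoin_ring_intros)
qed

lemma cong_root_mult:
  assumes "cong_root \<omega> x x'" "cong_root \<omega> y y'" "x \<in> adjoin_ring \<omega>" "y' \<in> adjoin_ring \<omega>"
  shows "cong_root \<omega> (x * y) (x' * y')"
proof -
  obtain r s where "r \<in> adjoin_ring \<omega>" "s \<in> adjoin_ring \<omega>"
    "x = x' + (\<omega> - 1) * r" "y = y' + (\<omega> - 1) * s"
    using assms by (auto simp: cong_root_def)
  moreover have "x * y = x' * y' + (\<omega> - 1) * (r * y' + x * s)"
  proof -
    have "x * y = x * y' + (\<omega> - 1) * (x * s)"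
      unfolding \<open>y = _\<close> by (simp add: algebra_simps)
    also have "x * y' = x' * y' + (\<omega> - 1) * (r * y')"
      unfolding \<open>x = _\<close> by (simp add: algebra_simps)
    finally show ?thesis by (simp add: algebra_simps)
  qed
  ultimately show ?thesis using assms unfolding cong_root_def
    by (intro bexI[of _ "r * y' + x * s"]) (auto intro: adjoin_ring_intros)
qed

lemma cong_root_power: "cong_root \<omega> (\<omega> ^ i) 1"
proof (induction i)
  case (Suc i)
  have "cong_root \<omega> \<omega> 1"
    unfolding cong_root_def by (intro bexI[of _ 1]) (auto intro: adjoin_ring_intros)
  from cong_root_mult[OF this Suc] show ?case by (auto intro: adjoin_ring_intros)
qed (simp add: cong_root_refl)

section \<open>Divided differences of monomials\<close>

text \<open>The divided difference of \<open>t \<mapsto> t\<^sup>j\<close> at the points \<open>xs\<close>, that is, the complete homogeneous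
  symmetric polynomial of degree \<open>j + 1 - length xs\<close> in \<open>xs\<close>. This recursion avoids division, so
  it makes sense modulo \<open>\<omega> - 1\<close>, where the points coincide. The value for the empty list only
  makes the recursion uniform.\<close>

fun divdiff :: "complex list \<Rightarrow> nat \<Rightarrow> complex" where
  "divdiff [] j = 0"
| "divdiff (x # xs) 0 = (if xs = [] then 1 else 0)"
| "divdiff (x # xs) (Suc j) = x * divdiff (x # xs) j + divdiff xs j"

lemma divdiff_single: "divdiff [x] j = x ^ j"
  by (induction j) auto

lemma divdiff_recursion:
  "(x - y) * divdiff (x # y # zs) j = divdiff (x # zs) j - divdiff (y # zs) j"
proof (induction j)
  case (Suc j)
  have "(x - y) * divdiff (x # y # zs) (Suc j)
      = x * ((x - y) * divdiff (x # y # zs) j) + (x - y) * divdiff (y # zs) j"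
    by (simp add: algebra_simps)
  then show ?case unfolding Suc by (simp add: algebra_simps)
qed simp

lemma divdiff_annihilates:
  assumes "xs \<noteq> []" "distinct xs" "\<And>x. x \<in> set xs \<Longrightarrow> (\<Sum>j\<in>J. w j * x ^ j) = 0"
  shows "(\<Sum>j\<in>J. w j * divdiff xs j) = 0"
  using assms
proof (induction xs rule: length_induct)
  case (1 xs)
  consider x where "xs = [x]" | x y zs where "xs = x # y # zs"
    using 1(2) by (metis neq_Nil_conv)
  then show ?case
  proof cases
    case 1
    then show ?thesis using "1.prems" by (simp add: divdiff_single)
  next
    case (2 x y zs)
    have "(\<Sum>j\<in>J. w j * divdiff (x # zs) j) = 0" "(\<Sum>j\<in>J. w j * divdiff (y # zs) j) = 0"
      using 1 by (auto simp: 2)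
    then have "(x - y) * (\<Sum>j\<in>J. w j * divdiff xs j) = 0"
      unfolding 2 by (simp add: sum_distrib_left mult.left_commute divdiff_recursion
          right_diff_distrib sum_subtractf)
    then show ?thesis using 1(3) by (simp add: 2)
  qed
qed

text \<open>When all points are \<open>1\<close>, the defining recursion becomes that of Pascal's triangle.\<close>

lemma divdiff_cong_binomial:
  assumes "set (x # xs) \<subseteq> range (\<lambda>i. \<omega> ^ i)"
  shows "cong_root \<omega> (divdiff (x # xs) j) (of_nat (j choose length xs))"
  using assms
proof (induction j arbitrary: x xs)
  case 0
  then show ?case by (cases xs) (auto simp: cong_root_refl)
next
  case (Suc j)
  obtain i where x: "x = \<omega> ^ i" using Suc.prems by auto
  have "cong_root \<omega> (x * divdiff (x # xs) j) (1 * of_nat (j choose length xs))"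
    using Suc unfolding x
    by (intro cong_root_mult cong_root_power) (auto intro: adjoin_ring_intros)
  moreover have "cong_root \<omega> (divdiff xs j) (of_nat (if xs = [] then 0 else j choose (length xs - 1)))"
  proof (cases xs)
    case (Cons y ys)
    then show ?thesis using Suc.IH[of y ys] Suc.prems by simp
  qed (simp add: cong_root_refl)
  ultimately have "cong_root \<omega> (divdiff (x # xs) (Suc j)) (1 * of_nat (j choose length xs) + of_nat (if xs = [] then 0 else j choose (length xs - 1)))"
    unfolding divdiff.simps(3) by (rule cong_root_add)
  moreover have "1 * of_nat (j choose length xs) + of_nat (if xs = [] then 0 else j choose (length xs - 1)) = (of_nat (Suc j choose length xs) :: complex)"
    by (cases xs) auto
  ultimately show ?case by simp
qed

section \<open>Finitely generated torsion-free modules divisible by p vanish\<close>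

text \<open>\<open>\<complex>\<close> is a vector space over the rationals: extend \<open>m\<close> to a basis and take the coordinate of \<open>m\<close>.\<close>

lemma exists_rat_functional:
  assumes "(m :: complex) \<noteq> 0"
  obtains \<psi> :: "complex \<Rightarrow> rat"
  where "\<And>x y. \<psi> (x + y) = \<psi> x + \<psi> y" "\<psi> m \<noteq> 0"
proof -
  interpret vector_space "\<lambda>(q::rat) (z::complex). of_rat q * z"
    by unfold_locales (auto simp: algebra_simps of_rat_add of_rat_mult)
  define B where "B = extend_basis {m}"
  have ind: "independent {m}" using assms by (simp add: dependent_single)
  have B: "independent B" "span B = UNIV" "m \<in> B"
    using independent_extend_basis[OF ind] span_extend_basis[OF ind] extend_basis_superset[OF ind]
    by (auto simp: B_def)
  show ?thesis
    using B by (intro that[of "\<lambda>z. representation B z m"])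
      (auto simp: representation_add representation_basis)
qed

lemma common_denominator:
  assumes "finite (X :: rat set)"
  obtains d :: int where "d \<noteq> 0" "\<And>x. x \<in> X \<Longrightarrow> of_int d * x \<in> \<int>"
  using assms
proof (induction X arbitrary: thesis rule: finite_induct)
  case empty
  show ?case by (rule empty(1)[of 1]) auto
next
  case (insert x X)
  obtain d where d: "d \<noteq> 0" "\<And>x. x \<in> X \<Longrightarrow> of_int d * x \<in> \<int>" using insert.IH by blast
  obtain a b where q: "x = of_int a / of_int b" "b > 0"
    by (metis quotient_of_div quotient_of_denom_pos surj_pair)
  have "of_int (b * d) * x = of_int (d * a)" using q by (simp add: field_simps)
  then have "of_int (b * d) * x \<in> \<int>" by (metis Ints_of_int)
  moreover have "of_int (b * d) * y \<in> \<int>" if "y \<in> X" for y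
    using Ints_mult[OF Ints_of_int d(2)[OF that], of b] by (simp add: mult.assoc)
  ultimately show ?case using d(1) q(2) by (intro insert.prems[of "b * d"]) auto
qed

text \<open>The module is generated as an abelian group by the finitely many \<open>\<omega>\<^sup>a g\<close> with \<open>a < p\<close>, so a
  rational functional becomes integer valued on it after clearing denominators. Its values are
  then divisible by every power of \<open>p\<close>, hence zero; but a nonzero \<open>m\<close> is detected by some functional.\<close>

lemma divisible_adjoin_span_zero:
  fixes p :: nat
  assumes "p > 1" "\<omega> ^ p = 1" "finite G"
    and div: "\<And>x. x \<in> adjoin_span \<omega> G \<Longrightarrow> \<exists>y\<in>adjoin_span \<omega> G. x = of_nat p * y"
    and m: "m \<in> adjoin_span \<omega> G"
  shows "m = 0"
proof (rule ccontr)
  assume "m \<noteq> 0"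
  then obtain \<psi> :: "complex \<Rightarrow> rat" where \<psi>: "\<And>x y. \<psi> (x + y) = \<psi> x + \<psi> y" "\<psi> m \<noteq> 0"
    using exists_rat_functional by blast
  have \<psi>0: "\<psi> 0 = 0" using \<psi>(1)[of 0 0] by simp
  have \<psi>u: "\<psi> (- x) = - \<psi> x" for x using \<psi>(1)[of x "- x"] \<psi>0 by simp
  have \<psi>n: "\<psi> (of_nat k * x) = of_nat k * \<psi> x" for k x
    by (induction k) (auto simp: \<psi>0 \<psi>(1) algebra_simps)
  have "finite ((\<lambda>(a, g). \<psi> (\<omega> ^ a * g)) ` ({..<p} \<times> G))" using assms(3) by simp
  then obtain d where d: "d \<noteq> 0"
    "\<And>x. x \<in> (\<lambda>(a, g). \<psi> (\<omega> ^ a * g)) ` ({..<p} \<times> G) \<Longrightarrow> of_int d * x \<in> \<int>"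
    using common_denominator by metis
  have int: "of_int d * \<psi> (\<omega> ^ a * x) \<in> \<int>" if "x \<in> adjoin_span \<omega> G" for x a
    using that
  proof (induction arbitrary: a)
    case (gen g)
    have "\<omega> ^ a = \<omega> ^ (p * (a div p) + a mod p)" by simp
    also have "\<dots> = \<omega> ^ (a mod p)" using assms(2) by (simp only: power_add power_mult) simp
    finally have "\<omega> ^ a = \<omega> ^ (a mod p)" .
    then have "\<psi> (\<omega> ^ a * g) \<in> (\<lambda>(a, g). \<psi> (\<omega> ^ a * g)) ` ({..<p} \<times> G)"
      using gen assms(1) by (intro image_eqI[of _ _ "(a mod p, g)"]) auto
    then show ?case by (rule d(2))
  next
    case (root x)
    then show ?case using root.IH[of "Suc a"] by (simp add: mult_ac)
  qed (auto simp: \<psi>0 \<psi>u \<psi> distrib_left)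
  have pow: "\<exists>z. of_int d * \<psi> x = of_int (int p ^ k * z)" if "x \<in> adjoin_span \<omega> G" for x k
    using that
  proof (induction k arbitrary: x)
    case 0
    then show ?case using int[OF 0, of 0] by (auto elim!: Ints_cases)
  next
    case (Suc k)
    obtain y where y: "y \<in> adjoin_span \<omega> G" "x = of_nat p * y" using div[OF Suc.prems] by blast
    obtain z where "of_int d * \<psi> y = of_int (int p ^ k * z)" using Suc.IH[OF y(1)] by blast
    moreover have "of_int d * \<psi> x = of_nat p * (of_int d * \<psi> y)" by (simp add: y(2) \<psi>n)
    ultimately have "of_int d * \<psi> x = of_int (int p ^ Suc k * z)" by simp
    then show ?case by blast
  qed
  obtain c where c: "of_int d * \<psi> m = of_int c" using pow[OF m, of 0] by auto
  have "c \<noteq> 0" using c d(1) \<psi>(2) by auto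
  obtain z where "of_int d * \<psi> m = of_int (int p ^ nat \<bar>c\<bar> * z)" using pow[OF m] by blast
  then have "c = int p ^ nat \<bar>c\<bar> * z" unfolding c of_int_eq_iff .
  then have "int p ^ nat \<bar>c\<bar> dvd c" by (rule dvdI)
  then have "\<bar>int p ^ nat \<bar>c\<bar>\<bar> \<le> \<bar>c\<bar>" using \<open>c \<noteq> 0\<close> by (intro dvd_imp_le_int)
  then have "int p ^ nat \<bar>c\<bar> \<le> \<bar>c\<bar>" by simp
  moreover have "nat \<bar>c\<bar> < p ^ nat \<bar>c\<bar>" using power_gt_expt[of p "nat \<bar>c\<bar>"] assms(1) by auto
  then have "int (nat \<bar>c\<bar>) < int p ^ nat \<bar>c\<bar>" by (metis of_nat_less_iff of_nat_power)
  ultimately show False by simp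
qed

section \<open>Chebotarev's theorem on minors of the Fourier matrix\<close>

lemma prime_root_of_unity_power_inj:
  assumes "prime (p::nat)" "(\<omega>::complex) ^ p = 1" "\<omega> \<noteq> 1"
  shows "inj_on (\<lambda>i. \<omega> ^ i) {..<p}"
proof (rule linorder_inj_onI)
  fix i j assume ij: "i < j" "i \<in> {..<p}" "j \<in> {..<p}"
  show "\<omega> ^ i \<noteq> \<omega> ^ j"
  proof
    assume eq: "\<omega> ^ i = \<omega> ^ j"
    have nz: "\<omega> \<noteq> 0" using assms by (metis power_0_left prime_gt_0_nat less_irrefl zero_neq_one)
    have "\<omega> ^ j = \<omega> ^ i * \<omega> ^ (j - i)" using ij by (simp flip: power_add)
    then have one: "\<omega> ^ (j - i) = 1" using eq nz by simp
    have "coprime (j - i) p" using ij assms(1)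
      by (metis coprime_commute diff_less_mono2 bot_nat_0.extremum_strict less_imp_diff_less lessThan_iff
          nat_dvd_not_less prime_imp_coprime zero_less_diff)
    then obtain x y where "(j - i) * x = p * y + 1"
      using bezout_nat[of "j - i" p] ij by (auto simp: coprime_iff_gcd_eq_1)
    then have "\<omega> ^ ((j - i) * x) = \<omega> ^ (p * y + 1)" by simp
    then show False using one assms by (simp add: power_mult power_add)
  qed
qed auto

text \<open>The ideals generated by \<open>p\<close> and by \<open>\<omega> - 1\<close> have the same radical, as \<open>p\<close> is totally ramified. The first
  part comes from \<open>\<Sum> \<omega>\<^sup>a = 0\<close>, whose \<open>p\<close> terms are all congruent to \<open>1\<close>; the second from expanding
  \<open>1 = \<omega>\<^sup>p = (1 + (\<omega> - 1))\<^sup>p\<close>.\<close>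

lemma ramified_prime:
  assumes "prime p" "\<omega> ^ p = 1" "\<omega> \<noteq> 1"
  shows "\<exists>r\<in>adjoin_ring \<omega>. of_nat p = (\<omega> - 1) * r"
    and "\<exists>r\<in>adjoin_ring \<omega>. (\<omega> - 1) ^ p = of_nat p * r"
proof -
  have s0: "(\<Sum>a<p. \<omega> ^ a) = 0" using assms by (simp add: geometric_sum)
  obtain r where r: "r i \<in> adjoin_ring \<omega>" "\<omega> ^ i = 1 + (\<omega> - 1) * r i" for i
    using cong_root_power[of \<omega>] unfolding cong_root_def by metis
  have "(\<Sum>a<p. \<omega> ^ a) = of_nat p + (\<omega> - 1) * (\<Sum>a<p. r a)"
    by (subst r(2)) (simp add: sum.distrib sum_distrib_left)
  then have "of_nat p = (\<omega> - 1) * (- (\<Sum>a<p. r a))" using s0 by (simp add: add_eq_0_iff)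
  then show "\<exists>r\<in>adjoin_ring \<omega>. of_nat p = (\<omega> - 1) * r"
    using r(1) by (intro bexI[of _ "- (\<Sum>a<p. r a)"] adjoin_span.uminus adjoin_span_sum)
next
  define y where "y = \<omega> - 1"
  have yR: "y \<in> adjoin_ring \<omega>" by (auto simp: y_def intro: adjoin_ring_intros)
  have p: "p > 0" using assms prime_gt_0_nat by blast
  define f where "f k = of_nat (p choose k) * y ^ k" for k
  have "1 = (y + 1) ^ p" using assms by (simp add: y_def)
  also have "\<dots> = (\<Sum>k\<le>p. f k)" by (simp add: binomial_ring f_def)
  also have "{..p} = insert 0 (insert p {0<..<p})" using p by auto
  also have "(\<Sum>k\<in>\<dots>. f k) = 1 + y ^ p + (\<Sum>k\<in>{0<..<p}. f k)" using p by (simp add: f_def)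
  also have "(\<Sum>k\<in>{0<..<p}. f k) = of_nat p * (\<Sum>k\<in>{0<..<p}. of_nat ((p choose k) div p) * y ^ k)"
  proof -
    have "f k = of_nat p * (of_nat ((p choose k) div p) * y ^ k)" if "k \<in> {0<..<p}" for k
    proof -
      have "p dvd (p choose k)" using that assms(1) by (intro dvd_choose_prime) auto
      then have "of_nat (p choose k) = (of_nat p * of_nat ((p choose k) div p) :: complex)"
        by (metis dvd_mult_div_cancel of_nat_mult)
      then show ?thesis by (simp add: f_def)
    qed
    then show ?thesis by (simp add: sum_distrib_left)
  qed
  finally have "y ^ p = of_nat p * (- (\<Sum>k\<in>{0<..<p}. of_nat ((p choose k) div p) * y ^ k))"
    by (simp add: add_eq_0_iff2 algebra_simps)
  then show "\<exists>r\<in>adjoin_ring \<omega>. (\<omega> - 1) ^ p = of_nat p * r"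
    unfolding y_def[symmetric]
    by (rule bexI) (intro adjoin_ring_intros yR)
qed

text \<open>The statement says that the columns \<open>J\<close> of the Fourier matrix stay independent when only the rows
  \<open>I\<close> are kept, provided that there are at least as many rows as columns. It is phrased
  for the coefficients \<open>w\<close> of a sparse polynomial with prescribed zeros, which is what the reduction
  modulo \<open>\<omega> - 1\<close> acts on.\<close>

theorem chebotarev_fourier_minors:
  fixes w :: "nat \<Rightarrow> complex"
  assumes p: "prime p" and \<omega>: "\<omega> ^ p = 1" "\<omega> \<noteq> 1"
    and I: "I \<subseteq> {..<p}" and J: "J \<subseteq> {..<p}" and card: "card J \<le> card I"
    and zero: "\<And>i. i \<in> I \<Longrightarrow> (\<Sum>j\<in>J. w j * \<omega> ^ (i * j)) = 0"
    and j: "j0 \<in> J"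
  shows "w j0 = 0"
proof -
  define M where "M = adjoin_span \<omega> (w ` J)"
  define N where "N = (\<lambda>x. (\<omega> - 1) * x) ` M"
  have fin: "finite I" "finite J" using I J finite_subset by blast+
  have N_add: "x + y \<in> N" if xy: "x \<in> N" "y \<in> N" for x y
  proof -
    obtain x' y' where "x' \<in> M" "y' \<in> M" "x = (\<omega> - 1) * x'" "y = (\<omega> - 1) * y'"
      using xy by (auto simp: N_def)
    then show ?thesis unfolding N_def M_def
      by (intro image_eqI[of _ _ "x' + y'"] adjoin_span.add) (simp_all add: distrib_left)
  qed
  have N_smult: "r * x \<in> N" if rx: "r \<in> adjoin_ring \<omega>" "x \<in> N" for r x
  proof -
    obtain x' where "x' \<in> M" "x = (\<omega> - 1) * x'" using rx(2) by (auto simp: N_def)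
    then show ?thesis unfolding N_def M_def
      using rx(1) by (intro image_eqI[of _ _ "r * x'"] adjoin_span_smult) (simp_all add: mult.left_commute)
  qed
  have gen: "w j \<in> M" if "j \<in> J" for j using that by (auto simp: M_def intro: adjoin_span.gen)
  have binom: "(\<Sum>j\<in>J. w j * of_nat (j choose r)) \<in> N" if r: "r < card I" for r
  proof -
    obtain ks where "distinct ks" "set ks = I" using fin(1) finite_distinct_list by blast
    then obtain ks' where ks': "distinct ks'" "set ks' \<subseteq> I" "length ks' = Suc r"
      using r by (metis Suc_leI distinct_card distinct_take length_take min.absorb2 set_take_subset)
    define xs where "xs = map (\<lambda>i. \<omega> ^ i) ks'"
    have d: "distinct xs" using ks' I prime_root_of_unity_power_inj[OF p \<omega>]
      by (auto simp: xs_def distinct_map intro: inj_on_subset)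
    have "(\<Sum>j\<in>J. w j * divdiff xs j) = 0"
      using d ks' zero by (intro divdiff_annihilates) (auto simp: xs_def subset_eq simp flip: power_mult)
    moreover have "cong_root \<omega> (divdiff xs j) (of_nat (j choose r))" for j
      using divdiff_cong_binomial[of "hd xs" "tl xs" \<omega> j] ks'(3)
      by (cases ks') (auto simp: xs_def)
    then obtain s where s: "s j \<in> adjoin_ring \<omega>" "divdiff xs j = of_nat (j choose r) + (\<omega> - 1) * s j" for j
      unfolding cong_root_def by metis
    ultimately have "0 = (\<Sum>j\<in>J. w j * of_nat (j choose r) + (\<omega> - 1) * (s j * w j))"
      by (simp add: distrib_left mult_ac)
    also have "\<dots> = (\<Sum>j\<in>J. w j * of_nat (j choose r)) + (\<omega> - 1) * (\<Sum>j\<in>J. s j * w j)"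
      by (simp add: sum.distrib sum_distrib_left)
    finally have "(\<Sum>j\<in>J. w j * of_nat (j choose r)) = (\<omega> - 1) * (- (\<Sum>j\<in>J. s j * w j))"
      by (simp add: add_eq_0_iff2)
    moreover have "- (\<Sum>j\<in>J. s j * w j) \<in> M"
      using s(1) gen by (auto simp: M_def intro!: adjoin_span.uminus adjoin_span_sum adjoin_span_smult)
    ultimately show ?thesis unfolding N_def by (rule image_eqI)
  qed
  \<comment> \<open>Integer polynomials of degree below \<open>card I\<close> are reached from the binomial coefficients by
    multiplying with one linear factor \<open>j - s\<close> at a time; \<open>r\<close> counts the degree still available.\<close>
  have interp: "(\<Sum>j\<in>J. w j * of_int (\<Prod>s\<in>S. int j - int s) * of_nat (j choose r)) \<in> N"
    if "finite S" "card S + r < card I" for S r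
    using that
  proof (induction S arbitrary: r rule: finite_induct)
    case empty
    then show ?case using binom by simp
  next
    case (insert a S)
    define Q where "Q j = w j * of_int (\<Prod>s\<in>S. int j - int s)" for j
    have "(int j - int a) * int (j choose r)
        = int (Suc r) * int (j choose Suc r) + (int r - int a) * int (j choose r)" for j
    proof -
      have "int (Suc r) * int (j choose Suc r) = (int j - int r) * int (j choose r)"
      proof (cases "r \<le> j")
        case True
        have "Suc r * (j choose Suc r) = (j - r) * (j choose r)"
          by (simp only: binomial_absorption binomial_absorb_comp)
        then have "int (Suc r * (j choose Suc r)) = int ((j - r) * (j choose r))" by simp
        then show ?thesis using True by (simp only: of_nat_mult of_nat_diff)
      qed (simp add: binomial_eq_0)
      then show ?thesis by (simp add: algebra_simps)
    qed
    from this[THEN arg_cong[where f = "of_int :: int \<Rightarrow> complex"]]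
    have e: "(of_nat j - of_nat a) * of_nat (j choose r)
        = of_nat (Suc r) * of_nat (j choose Suc r) + of_int (int r - int a) * (of_nat (j choose r) :: complex)" for j
      by simp
    have "(\<Sum>j\<in>J. w j * of_int (\<Prod>s\<in>insert a S. int j - int s) * of_nat (j choose r))
        = (\<Sum>j\<in>J. Q j * ((of_nat j - of_nat a) * of_nat (j choose r)))"
      using insert.hyps by (simp add: Q_def mult_ac)
    also have "\<dots> = of_nat (Suc r) * (\<Sum>j\<in>J. Q j * of_nat (j choose Suc r))
        + of_int (int r - int a) * (\<Sum>j\<in>J. Q j * of_nat (j choose r))"
      unfolding e sum_distrib_left sum.distrib[symmetric]
      by (rule sum.cong) (auto simp: algebra_simps)
    also have "\<dots> \<in> N"
      using insert.IH[of r] insert.IH[of "Suc r"] insert.prems insert.hyps unfolding Q_def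
      by (intro N_add N_smult adjoin_ring_of_nat adjoin_ring_of_int) auto
    finally show ?case .
  qed
  \<comment> \<open>The polynomial \<open>\<Prod>\<^sub>s (j - s)\<close> over the other indices \<open>s\<close> isolates \<open>w j\<close>; its value at \<open>j\<close> is
    prime to \<open>p\<close> because the indices are distinct modulo \<open>p\<close>.\<close>
  have gen_N: "w j \<in> N" if j: "j \<in> J" for j
  proof -
    define h where "h = (\<Prod>s\<in>J - {j}. int j - int s)"
    have "card J > 0" using j fin by (auto simp: card_gt_0_iff)
    then have "card (J - {j}) + 0 < card I" using j fin card by (simp add: card_Diff_singleton)
    from interp[OF _ this] have "(\<Sum>i\<in>J. w i * of_int (\<Prod>s\<in>J - {j}. int i - int s)) \<in> N"
      using fin by simp
    also have "(\<Sum>i\<in>J. w i * of_int (\<Prod>s\<in>J - {j}. int i - int s)) = (\<Sum>i\<in>J. if i = j then w j * of_int h else 0)"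
      using fin by (intro sum.cong) (auto simp: h_def)
    also have "\<dots> = w j * of_int h" using fin j by simp
    finally have hN: "of_int h * w j \<in> N" by (simp add: mult.commute)
    obtain r where r: "r \<in> adjoin_ring \<omega>" "of_nat p = (\<omega> - 1) * r"
      using ramified_prime(1)[OF p \<omega>] by blast
    have pN: "of_nat p * w j \<in> N" unfolding N_def r(2) mult.assoc
      using gen[OF j] r(1) by (auto simp: M_def intro: adjoin_span_smult)
    have "\<not> int p dvd h"
    proof
      assume "int p dvd h"
      then obtain s where s: "s \<in> J - {j}" "int p dvd int j - int s"
        using fin p by (auto simp: h_def prime_dvd_prod_iff)
      then have "\<bar>int p\<bar> \<le> \<bar>int j - int s\<bar>" by (intro dvd_imp_le_int) auto
      moreover have "j < p" "s < p" using s(1) j J by auto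
      ultimately show False by linarith
    qed
    then have "coprime (int p) h" using p by (simp add: prime_imp_coprime)
    then obtain u v where "u * int p + v * h = 1"
      by (metis bezout_int coprime_imp_gcd_eq_1)
    from arg_cong[OF this, of "of_int :: int \<Rightarrow> complex"]
    have "w j = of_int u * (of_nat p * w j) + of_int v * (of_int h * w j)"
      by (simp flip: mult.assoc distrib_right)
    also have "\<dots> \<in> N" by (rule N_add[OF N_smult[OF adjoin_ring_of_int pN] N_smult[OF adjoin_ring_of_int hN]])
    finally show ?thesis .
  qed
  have MN: "x \<in> N" if "x \<in> M" for x
    using that unfolding M_def
  proof induction
    case zero
    show ?case unfolding N_def M_def by (rule image_eqI[OF _ adjoin_span.zero]) simp
  next
    case (uminus x)
    then show ?case using N_smult[OF adjoin_ring_of_int, of x "- 1"] by simp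
  next
    case (root x)
    show ?case by (rule N_smult[OF adjoin_ring_root root.IH])
  qed (auto intro: gen_N N_add)
  have pow: "\<exists>y\<in>M. x = (\<omega> - 1) ^ k * y" if "x \<in> M" for x k
    using that
  proof (induction k arbitrary: x)
    case (Suc k)
    obtain y where "y \<in> M" "x = (\<omega> - 1) * y" using MN[OF Suc.prems] by (auto simp: N_def)
    then show ?case using Suc.IH[of y] by (auto simp: mult.assoc)
  qed auto
  obtain r where r: "r \<in> adjoin_ring \<omega>" "(\<omega> - 1) ^ p = of_nat p * r"
    using ramified_prime(2)[OF p \<omega>] by blast
  have pM: "\<exists>y\<in>M. x = of_nat p * y" if x: "x \<in> M" for x
  proof -
    obtain y where "y \<in> M" "x = (\<omega> - 1) ^ p * y" using pow[OF x] by blast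
    then show ?thesis unfolding r(2) mult.assoc using r(1)
      by (auto simp: M_def intro: adjoin_span_smult)
  qed
  show ?thesis
    by (rule divisible_adjoin_span_zero[OF prime_gt_1_nat[OF p] \<omega>(1) finite_imageI[OF fin(2), of w]])
      (use pM gen[OF j] in \<open>simp_all add: M_def\<close>)
qed

section \<open>Coordinates of the orbit vectors\<close>

text \<open>The coordinate \<open>j\<close> of \<open>\<kappa>(x) v\<close> is the coordinate \<open>orbit_index n x j\<close> of \<open>v\<close>.\<close>

definition orbit_index :: "nat \<Rightarrow> nat \<times> bool \<Rightarrow> nat \<Rightarrow> nat" where
  "orbit_index n x j =
     nat ((if snd x then int (fst x) - int j else int j - int (fst x)) mod int n)"

lemma orbit_index_less: "n > 0 \<Longrightarrow> orbit_index n x j < n"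
  by (simp add: orbit_index_def nat_less_iff)

lemma kappa_coordinate:
  assumes "v \<in> vecs (Cn n)" "x \<in> carrier (dihedral n)"
  shows "kappa n x v = (\<lambda>j. if j < n then v (orbit_index n x j) else 0)"
  using assms kappa_eq[of v n "fst x" "snd x"] by (auto simp: dihedral_simps orbit_index_def)

lemma orbit_index_bij:
  assumes "n > 0"
  shows "bij_betw (orbit_index n x) {..<n} {..<n}"
proof -
  obtain i b where x: "x = (i, b)" by fastforce
  have nm: "int (nat (z mod int n)) = z mod int n" for z using assms by simp
  show ?thesis
    by (rule bij_betwI[where g = "\<lambda>j. nat ((if b then int i - int j else int j + int i) mod int n)"])
      (use assms in \<open>auto simp: x orbit_index_def nm mod_simps nat_less_iff\<close>)
qed

section \<open>Degenerate orbits for even n\<close>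

lemma even_orbit_index_parity:
  assumes "even n" "n > 0" "even (fst x)"
  shows "even (orbit_index n x j) \<longleftrightarrow> even j"
proof -
  have "even (nat (z mod int n)) \<longleftrightarrow> even z" for z
    using assms by (simp add: even_nat_iff dvd_mod_iff)
  then show ?thesis using assms by (auto simp: orbit_index_def)
qed

text \<open>Rotations and reflections \<open>x\<close> with even rotation part permute the coordinates and
  respect their parity, so the sum \<open>a\<close> and the alternating sum \<open>b\<close> of the coordinates are the same
  for all vectors \<open>\<kappa>(x) v\<close>. The functional \<open>b \<cdot> 1 - a \<cdot> \<chi>\<close> kills them; it is nonzero unless
  \<open>a = b = 0\<close>, and in that case the sum itself does.\<close>

lemma even_orbit_functional:
  fixes v :: "nat \<Rightarrow> complex"
  assumes n: "even n" "n > 0"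
  obtains g :: "nat \<Rightarrow> complex" and j0 where "j0 < n" "g j0 \<noteq> 0"
    "\<And>x. even (fst x) \<Longrightarrow> (\<Sum>j<n. g j * v (orbit_index n x j)) = 0"
proof -
  define \<chi> :: "nat \<Rightarrow> complex" where "\<chi> j = (-1) ^ j" for j
  define a where "a = (\<Sum>j<n. v j)"
  define b where "b = (\<Sum>j<n. \<chi> j * v j)"
  have a: "(\<Sum>j<n. v (orbit_index n x j)) = a" for x
    using sum.reindex_bij_betw[OF orbit_index_bij, of n v] n by (simp add: a_def)
  have b: "(\<Sum>j<n. \<chi> j * v (orbit_index n x j)) = b" if "even (fst x)" for x
  proof -
    have "(\<Sum>j<n. \<chi> j * v (orbit_index n x j)) = (\<Sum>j<n. \<chi> (orbit_index n x j) * v (orbit_index n x j))"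
      using even_orbit_index_parity[OF n that] by (intro sum.cong) (auto simp: \<chi>_def minus_one_power_iff)
    then show ?thesis
      using sum.reindex_bij_betw[OF orbit_index_bij, of n "\<lambda>j. \<chi> j * v j"] n by (simp add: b_def)
  qed
  have n2: "0 < n" "1 < n" using n by (auto elim!: evenE)
  show ?thesis
  proof (cases "a = 0 \<and> b = 0")
    case True
    then show ?thesis using a n by (intro that[of 0 "\<lambda>_. 1"]) auto
  next
    case False
    define g where "g j = b - a * \<chi> j" for j
    have "(\<Sum>j<n. g j * v (orbit_index n x j)) = 0" if "even (fst x)" for x
    proof -
      have "(\<Sum>j<n. g j * v (orbit_index n x j))
          = b * (\<Sum>j<n. v (orbit_index n x j)) - a * (\<Sum>j<n. \<chi> j * v (orbit_index n x j))"
        by (simp add: g_def left_diff_distrib sum_subtractf sum_distrib_left mult.assoc)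
      then show ?thesis by (simp add: a b[OF that])
    qed
    moreover have "g 0 \<noteq> 0 \<or> g 1 \<noteq> 0"
    proof (rule ccontr)
      assume "\<not> ?thesis"
      then have "b = a" "b = - a" by (auto simp: g_def \<chi>_def add_eq_0_iff2)
      then show False using False by simp
    qed
    ultimately show ?thesis using n2 that by blast
  qed
qed

section \<open>Nonsingular orbits for prime n\<close>

lemma exists_root_of_unity:
  assumes "n > 1"
  obtains \<omega> :: complex where "\<omega> ^ n = 1" "\<omega> \<noteq> 1"
proof -
  have "card {z::complex. z ^ n = 1} = n" using assms by (intro card_roots_unity_eq) auto
  then have "\<not> {z::complex. z ^ n = 1} \<subseteq> {1}"
    using assms card_mono[of "{1::complex}" "{z. z ^ n = 1}"] by auto
  then show ?thesis using that by blast
qed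

text \<open>The rows \<open>X\<close> only involve columns outside \<open>T\<close> and their number is that of these columns, so they
  determine \<open>h\<close> there; as \<open>T\<close> is contained in the columns seen by \<open>Y\<close>, the rows \<open>Y\<close> then determine \<open>h\<close>
  on \<open>T\<close>.\<close>

lemma block_triangular_fourier_system:
  fixes h :: "nat \<Rightarrow> complex"
  assumes p: "prime n" and \<omega>: "\<omega> ^ n = 1" "\<omega> \<noteq> 1"
    and T: "T \<subseteq> {..<n}" "T' \<subseteq> {..<n}" "T \<inter> T' = {}"
    and XY: "X \<subseteq> {..<n}" "Y \<subseteq> {..<n}" "card X = n - card T" "card Y = card T"
    and X: "\<And>i. i \<in> X \<Longrightarrow> (\<Sum>k\<in>{..<n} - T. h k * \<omega> ^ (i * k)) = 0"
    and Y: "\<And>i. i \<in> Y \<Longrightarrow> (\<Sum>k\<in>{..<n} - T'. h k * \<omega> ^ (i * k)) = 0"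
    and k: "k < n"
  shows "h k = 0"
proof -
  have fin: "finite T" using T(1) finite_subset by blast
  have le: "card ({..<n} - T) \<le> card X" using T(1) XY(3) fin by (simp add: card_Diff_subset)
  have 1: "h k = 0" if "k \<in> {..<n} - T" for k
    using chebotarev_fourier_minors[OF p \<omega> XY(1) Diff_subset le X that] .
  have "(\<Sum>k\<in>T. h k * \<omega> ^ (i * k)) = 0" if "i \<in> Y" for i
  proof -
    have "(\<Sum>k\<in>T. h k * \<omega> ^ (i * k)) = (\<Sum>k\<in>{..<n} - T'. h k * \<omega> ^ (i * k))"
      using T 1 by (intro sum.mono_neutral_left) auto
    then show ?thesis using Y[OF that] by simp
  qed
  then have "h k = 0" if "k \<in> T" for k
    using chebotarev_fourier_minors[OF p \<omega> XY(2) T(1) _ _ that] XY(4) by simp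
  with 1 k show ?thesis by blast
qed

text \<open>If \<open>a\<close> lists the Fourier coefficients of \<open>c\<close>, a rotation multiplies them by characters, and a
  reflection moreover replaces \<open>k\<close> by \<open>-k\<close>. The vector \<open>h\<close> is the transform of the
  column vector \<open>w\<close> that the orbit matrix is applied to.\<close>

lemma orbit_fourier:
  fixes a w :: "nat \<Rightarrow> complex" and n
  assumes n: "n > 0" and \<omega>: "\<omega> ^ n = 1"
  defines "c \<equiv> \<lambda>j. if j < n then \<Sum>k<n. a k * inverse \<omega> ^ (j * k) else 0"
    and "h \<equiv> \<lambda>k. \<Sum>j<n. w j * inverse \<omega> ^ (k * j)"
  shows "(\<Sum>j<n. c (orbit_index n (i, False) j) * w j) = (\<Sum>k<n. a k * (h k * \<omega> ^ (i * k)))"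
    and "(\<Sum>j<n. c (orbit_index n (i, True) j) * w j) = (\<Sum>k<n. a ((n - k) mod n) * (h k * \<omega> ^ (i * k)))"
proof -
  define \<epsilon> where "\<epsilon> z = \<omega> powi z" for z
  have nz: "\<omega> \<noteq> 0" using n \<omega> by (metis power_0_left less_irrefl zero_neq_one)
  have add: "\<epsilon> (x + y) = \<epsilon> x * \<epsilon> y" for x y using nz by (simp add: \<epsilon>_def power_int_add)
  have per: "\<epsilon> (int n * z) = 1" for z using \<omega> by (simp add: \<epsilon>_def power_int_mult)
  have modn: "\<epsilon> x = \<epsilon> y" if "x mod int n = y mod int n" for x y
  proof -
    have "int n dvd x - y" using that by (simp add: mod_eq_dvd_iff)
    then obtain z where "x - y = int n * z" by (rule dvdE)
    then have "x = y + int n * z" by simp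
    then show ?thesis by (simp add: add per)
  qed
  have inv: "inverse \<omega> ^ k = \<epsilon> (- int k)" for k by (simp add: \<epsilon>_def power_int_minus power_inverse)
  have pos: "\<omega> ^ k = \<epsilon> (int k)" for k by (simp add: \<epsilon>_def)
  have c: "c (nat (z mod int n)) = (\<Sum>k<n. a k * \<epsilon> (- (z * int k)))" for z
  proof -
    have "nat (z mod int n) < n" using n by (simp add: nat_less_iff)
    moreover have "\<epsilon> (- (int (nat (z mod int n)) * int k)) = \<epsilon> (- (z * int k))" for k
      using n by (intro modn) (simp, metis mod_minus_cong mod_mult_left_eq)
    ultimately show ?thesis by (simp add: c_def inv)
  qed
  have "(\<Sum>j<n. c (orbit_index n (i, False) j) * w j)
      = (\<Sum>j<n. \<Sum>k<n. a k * (\<epsilon> (- (int k * int j)) * w j * \<epsilon> (int i * int k)))"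
    unfolding orbit_index_def
    by (simp add: c sum_distrib_left sum_distrib_right algebra_simps flip: add)
  also have "\<dots> = (\<Sum>k<n. a k * (h k * \<omega> ^ (i * k)))"
    by (subst sum.swap) (simp add: h_def inv pos sum_distrib_left sum_distrib_right mult_ac)
  finally show "(\<Sum>j<n. c (orbit_index n (i, False) j) * w j) = (\<Sum>k<n. a k * (h k * \<omega> ^ (i * k)))" .
  have neg: "bij_betw (\<lambda>k. (n - k) mod n) {..<n} {..<n}"
  proof (rule bij_betwI[where g = "\<lambda>k. (n - k) mod n"])
    show "(n - (n - k) mod n) mod n = k" if "k \<in> {..<n}" for k
      using that by (cases "k = 0") auto
    then show "(n - (n - k) mod n) mod n = k" if "k \<in> {..<n}" for k using that .
  qed (use n in auto)
  have c': "c (nat (z mod int n)) = (\<Sum>k<n. a ((n - k) mod n) * \<epsilon> (z * int k))" for z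
  proof -
    have "\<epsilon> (- (z * int ((n - k) mod n))) = \<epsilon> (z * int k)" if "k < n" for k
    proof (rule modn)
      have "int ((n - k) mod n) = (int n - int k) mod int n"
        using that by (simp only: of_nat_mod of_nat_diff less_imp_le)
      then have "(- (z * int ((n - k) mod n))) mod int n = (- (z * (int n - int k))) mod int n"
        by (simp only: mod_minus_cong[OF mod_mult_right_eq])
      also have "- (z * (int n - int k)) = z * int k + int n * (- z)" by (simp add: algebra_simps)
      finally show "(- (z * int ((n - k) mod n))) mod int n = (z * int k) mod int n"
        by (simp only: mod_mult_self2)
    qed
    then have "(\<Sum>k<n. a ((n - k) mod n) * \<epsilon> (z * int k))
        = (\<Sum>k<n. a ((n - k) mod n) * \<epsilon> (- (z * int ((n - k) mod n))))" by simp
    also have "\<dots> = (\<Sum>k<n. a k * \<epsilon> (- (z * int k)))" by (rule sum.reindex_bij_betw[OF neg])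
    finally show ?thesis by (simp add: c)
  qed
  have "(\<Sum>j<n. c (orbit_index n (i, True) j) * w j)
      = (\<Sum>j<n. \<Sum>k<n. a ((n - k) mod n) * (\<epsilon> (- (int k * int j)) * w j * \<epsilon> (int i * int k)))"
    unfolding orbit_index_def
    by (simp add: c' sum_distrib_left sum_distrib_right algebra_simps flip: add)
  also have "\<dots> = (\<Sum>k<n. a ((n - k) mod n) * (h k * \<omega> ^ (i * k)))"
    by (subst sum.swap) (simp add: h_def inv pos sum_distrib_left sum_distrib_right mult_ac)
  finally show "(\<Sum>j<n. c (orbit_index n (i, True) j) * w j)
      = (\<Sum>k<n. a ((n - k) mod n) * (h k * \<omega> ^ (i * k)))" .
qed

text \<open>Put \<open>q\<close> for the number of rotations or of reflections in \<open>K\<close>, whichever is smaller. The indices \<open>lo\<close>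
  and their negatives \<open>hi\<close> are disjoint sets of size \<open>q\<close>. Choosing the Fourier coefficients to be \<open>0\<close> on
  one of them and \<open>1\<close> elsewhere, the more frequent kind of row misses exactly the columns \<open>lo\<close>, the other
  kind exactly the columns \<open>hi\<close>, which is the block triangular situation above.\<close>

lemma exists_nonsingular_orbit:
  assumes p: "prime n" "n > 2" and K: "K \<subseteq> carrier (dihedral n)" "card K = n"
  obtains c :: "nat \<Rightarrow> complex" where "c \<in> vecs (Cn n)"
    "\<And>w j. (\<And>x. x \<in> K \<Longrightarrow> (\<Sum>j<n. c (orbit_index n x j) * w j) = 0) \<Longrightarrow> j < n \<Longrightarrow> w j = 0"
proof -
  obtain \<omega> :: complex where \<omega>: "\<omega> ^ n = 1" "\<omega> \<noteq> 1" using exists_root_of_unity[of n] p(2) by auto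
  have \<omega>': "inverse \<omega> ^ n = 1" "inverse \<omega> \<noteq> 1" using \<omega> by (auto simp: power_inverse)
  define A where "A = {i. (i, False) \<in> K}"
  define B where "B = {i. (i, True) \<in> K}"
  have AB: "A \<subseteq> {..<n}" "B \<subseteq> {..<n}" using K by (auto simp: A_def B_def dihedral_simps)
  then have fin: "finite A" "finite B" using finite_subset by blast+
  have "K = (\<lambda>i. (i, False)) ` A \<union> (\<lambda>i. (i, True)) ` B"
  proof (rule Set.set_eqI)
    show "x \<in> K \<longleftrightarrow> x \<in> (\<lambda>i. (i, False)) ` A \<union> (\<lambda>i. (i, True)) ` B" for x
      by (cases x, cases "snd x") (auto simp: A_def B_def)
  qed
  then have "n = card ((\<lambda>i. (i, False)) ` A \<union> (\<lambda>i. (i, True)) ` B)" using K by simp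
  also have "\<dots> = card A + card B"
    using fin by (subst card_Un_disjoint) (auto simp: card_image inj_on_def)
  finally have cAB: "n = card A + card B" .
  have odd: "odd n" using p prime_odd_nat by blast
  define q where "q = min (card A) (card B)"
  have "card A \<noteq> card B" using odd cAB by auto
  then have q: "2 * q < n" using cAB by (auto simp: q_def)
  define lo where "lo = {1..q}"
  define hi where "hi = {n - q..<n}"
  have lohi: "lo \<subseteq> {..<n}" "hi \<subseteq> {..<n}" "lo \<inter> hi = {}" "card lo = q" "card hi = q"
    using q by (auto simp: lo_def hi_def)
  have neg: "(n - k) mod n \<in> lo \<longleftrightarrow> k \<in> hi" "(n - k) mod n \<in> hi \<longleftrightarrow> k \<in> lo" if "k < n" for k
  proof -
    have "(n - k) mod n = (if k = 0 then 0 else n - k)" using that by auto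
    then show "(n - k) mod n \<in> lo \<longleftrightarrow> k \<in> hi" "(n - k) mod n \<in> hi \<longleftrightarrow> k \<in> lo"
      using that q unfolding lo_def hi_def by auto
  qed
  \<comment> \<open>Rotation rows miss the columns \<open>Z\<close>, reflection rows the negatives of \<open>Z\<close>; \<open>Z\<close> is chosen so
    that the more frequent kind misses \<open>lo\<close>.\<close>
  define Z where "Z = (if card A < card B then hi else lo)"
  define a :: "nat \<Rightarrow> complex" where "a k = (if k \<in> Z then 0 else 1)" for k
  define c where "c j = (if j < n then \<Sum>k<n. a k * inverse \<omega> ^ (j * k) else 0)" for j
  show ?thesis
  proof (rule that)
    show "c \<in> vecs (Cn n)" by (simp add: c_def vecs_Cn)
    fix w :: "nat \<Rightarrow> complex" and j
    assume w: "\<And>x. x \<in> K \<Longrightarrow> (\<Sum>j<n. c (orbit_index n x j) * w j) = 0" and j: "j < n"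
    define h where "h k = (\<Sum>j<n. w j * inverse \<omega> ^ (k * j))" for k
    have n: "n > 0" using p by simp
    define Z' where "Z' = (if card A < card B then lo else hi)"
    have rowA: "(\<Sum>k\<in>{..<n} - Z. h k * \<omega> ^ (i * k)) = 0" if "i \<in> A" for i
    proof -
      have "(\<Sum>k\<in>{..<n} - Z. h k * \<omega> ^ (i * k)) = (\<Sum>k<n. a k * (h k * \<omega> ^ (i * k)))"
        by (rule sum.mono_neutral_cong_left) (auto simp: a_def)
      also have "\<dots> = (\<Sum>j<n. c (orbit_index n (i, False) j) * w j)"
        using orbit_fourier(1)[OF n \<omega>(1), where a = a and i = i and w = w] by (simp add: c_def h_def)
      finally show ?thesis using w that by (simp add: A_def)
    qed
    have rowB: "(\<Sum>k\<in>{..<n} - Z'. h k * \<omega> ^ (i * k)) = 0" if "i \<in> B" for i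
    proof -
      have "(\<Sum>k\<in>{..<n} - Z'. h k * \<omega> ^ (i * k)) = (\<Sum>k<n. a ((n - k) mod n) * (h k * \<omega> ^ (i * k)))"
        by (rule sum.mono_neutral_cong_left) (auto simp: a_def Z_def Z'_def neg)
      also have "\<dots> = (\<Sum>j<n. c (orbit_index n (i, True) j) * w j)"
        using orbit_fourier(2)[OF n \<omega>(1), where a = a and i = i and w = w] by (simp add: c_def h_def)
      finally show ?thesis using w that by (simp add: B_def)
    qed
    have "h k = 0" if "k < n" for k
    proof (cases "card A < card B")
      case True
      then have Z: "Z = hi" "Z' = lo" by (simp_all add: Z_def Z'_def)
      have "card B = n - card lo" "card A = card lo" using True cAB lohi by (simp_all add: q_def)
      from block_triangular_fourier_system[OF p(1) \<omega> lohi(1-3) AB(2,1) this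
          rowB[unfolded Z] rowA[unfolded Z] that]
      show ?thesis .
    next
      case False
      then have Z: "Z = lo" "Z' = hi" by (simp_all add: Z_def Z'_def)
      have "card A = n - card lo" "card B = card lo" using False cAB lohi by (simp_all add: q_def)
      from block_triangular_fourier_system[OF p(1) \<omega> lohi(1-3) AB this
          rowA[unfolded Z] rowB[unfolded Z] that]
      show ?thesis .
    qed
    then have "(\<Sum>j\<in>{..<n}. w j * inverse \<omega> ^ (k * j)) = 0" if "k \<in> {..<n}" for k
      using that by (simp add: h_def)
    from chebotarev_fourier_minors[OF p(1) \<omega>' subset_refl subset_refl order_refl this]
    show "w j = 0" using j by simp
  qed
qed

section \<open>Generic nonvanishing of the orbit minors\<close>

lemma polynomial_fun_sum:
  "(\<And>i. i \<in> A \<Longrightarrow> f i \<in> polynomial_fun n) \<Longrightarrow> (\<lambda>c. \<Sum>i\<in>A. f i c) \<in> polynomial_fun n"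
  by (induction A rule: infinite_finite_induct) (auto intro: polynomial_fun.intros)

lemma polynomial_fun_prod:
  "(\<And>i. i \<in> A \<Longrightarrow> f i \<in> polynomial_fun n) \<Longrightarrow> (\<lambda>c. \<Prod>i\<in>A. f i c) \<in> polynomial_fun n"
  by (induction A rule: infinite_finite_induct) (auto intro: polynomial_fun.intros)

lemma polynomial_fun_on_line:
  assumes "P \<in> polynomial_fun n"
  shows "\<exists>q. \<forall>t. poly q t = P (\<lambda>j. u j + t * d j)"
  using assms
proof induction
  case (const a)
  show ?case by (rule exI[of _ "[:a:]"]) simp
next
  case (coord j)
  show ?case by (rule exI[of _ "[:u j, d j:]"]) simp
next
  case (add p q)
  then show ?case by (metis poly_add)
next
  case (mult p q)
  then show ?case by (metis poly_mult)
qed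

text \<open>On the line through \<open>u\<close> and \<open>v\<close> both functions are nonzero univariate polynomials.\<close>

lemma polynomial_fun_no_zero_divisors:
  assumes "P \<in> polynomial_fun n" "Q \<in> polynomial_fun n"
    and "u \<in> vecs (Cn n)" "P u \<noteq> 0" "v \<in> vecs (Cn n)" "Q v \<noteq> 0"
  shows "\<exists>c\<in>vecs (Cn n). P c * Q c \<noteq> 0"
proof -
  let ?l = "\<lambda>t j. u j + t * (v j - u j)"
  obtain f g where f: "\<And>t. poly f t = P (?l t)" and g: "\<And>t. poly g t = Q (?l t)"
    using polynomial_fun_on_line[OF assms(1), of u "\<lambda>j. v j - u j"]
      polynomial_fun_on_line[OF assms(2), of u "\<lambda>j. v j - u j"] by blast
  have "poly f 0 \<noteq> 0" "poly g 1 \<noteq> 0" using assms by (simp_all add: f g)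
  then have "f * g \<noteq> 0" by auto
  then obtain t where "poly (f * g) t \<noteq> 0" using poly_all_0_iff_0 by blast
  then show ?thesis using assms(3,5) by (intro bexI[of _ "?l t"]) (auto simp: f g vecs_Cn)
qed

lemma polynomial_fun_prod_nonzero:
  assumes "finite A"
    "\<And>i. i \<in> A \<Longrightarrow> P i \<in> polynomial_fun n \<and> (\<exists>c\<in>vecs (Cn n). P i c \<noteq> 0)"
  shows "\<exists>c\<in>vecs (Cn n). (\<Prod>i\<in>A. P i c) \<noteq> 0"
  using assms
proof (induction A rule: finite_induct)
  case empty
  show ?case by (auto simp: vecs_Cn intro!: exI[of _ "\<lambda>_. 0"])
next
  case (insert i A)
  then obtain u v where "u \<in> vecs (Cn n)" "P i u \<noteq> 0" "v \<in> vecs (Cn n)" "(\<Prod>i\<in>A. P i v) \<noteq> 0"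
    by blast
  then have "\<exists>c\<in>vecs (Cn n). P i c * (\<Prod>i\<in>A. P i c) \<noteq> 0"
    using insert by (intro polynomial_fun_no_zero_divisors polynomial_fun_prod) auto
  then show ?case using insert.hyps by simp
qed

lemma polynomial_fun_det:
  assumes "\<And>i j. i < m \<Longrightarrow> j < m \<Longrightarrow> f i j \<in> polynomial_fun n"
  shows "(\<lambda>c. det (mat m m (\<lambda>(i, j). f i j c))) \<in> polynomial_fun n"
proof -
  have "(\<lambda>c. det (mat m m (\<lambda>(i, j). f i j c)))
      = (\<lambda>c. \<Sum>\<pi>\<in>{\<pi>. \<pi> permutes {0..<m}}. signof \<pi> * (\<Prod>i\<in>{0..<m}. f i (\<pi> i) c))"
    by (rule ext, subst det_def'[OF mat_carrier], intro sum.cong prod.cong arg_cong2[where f = "(*)"])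
      (auto dest: permutes_in_image)
  also have "\<dots> \<in> polynomial_fun n"
    using assms
    by (intro polynomial_fun_sum polynomial_fun.mult polynomial_fun.const polynomial_fun_prod)
      (auto dest: permutes_in_image)
  finally show ?thesis .
qed

text \<open>Linear independence of the family \<open>(\<kappa>(x) c)\<^sub>x\<^sub>\<in>\<^sub>K\<close> in \<open>\<complex>\<^sup>n\<close>, by coordinates.\<close>

definition orbit_independent :: "nat \<Rightarrow> (nat \<times> bool) set \<Rightarrow> (nat \<Rightarrow> complex) \<Rightarrow> bool" where
  "orbit_independent n K c \<longleftrightarrow>
     (\<forall>a. (\<forall>j<n. (\<Sum>x\<in>K. a x * c (orbit_index n x j)) = 0) \<longrightarrow> (\<forall>x\<in>K. a x = 0))"

text \<open>The polynomial is the determinant of the orbit matrix. It is not identically zero because of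
  \<open>exists_nonsingular_orbit\<close>, which concerns its columns, while independence of the orbit vectors
  concerns its rows.\<close>

lemma orbit_minor_polynomial:
  assumes "prime n" "n > 2" and K: "K \<subseteq> carrier (dihedral n)" "card K = n"
  shows "\<exists>P\<in>polynomial_fun n. (\<exists>c\<in>vecs (Cn n). P c \<noteq> 0) \<and>
    (\<forall>c. P c \<noteq> 0 \<longrightarrow> orbit_independent n K c)"
proof -
  have n: "n > 0" using assms by simp
  have finK: "finite K" using K n card_ge_0_finite by auto
  then obtain e where e: "bij_betw e {0..<n} K" using K ex_bij_betw_nat_finite by blast
  define M where "M c = mat n n (\<lambda>(r, j). c (orbit_index n (e r) j))" for c :: "nat \<Rightarrow> complex"
  have M: "M c \<in> carrier_mat n n" for c by (simp add: M_def)
  show ?thesis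
  proof (rule bexI[where x = "\<lambda>c. det (M c)"], intro conjI allI impI)
    show "(\<lambda>c. det (M c)) \<in> polynomial_fun n" unfolding M_def
      by (intro polynomial_fun_det polynomial_fun.coord orbit_index_less n)
    obtain c where c: "c \<in> vecs (Cn n)"
      "\<And>w j. (\<And>x. x \<in> K \<Longrightarrow> (\<Sum>j<n. c (orbit_index n x j) * w j) = 0) \<Longrightarrow> j < n \<Longrightarrow> w j = 0"
      using exists_nonsingular_orbit[OF assms] by blast
    have "det (M c) \<noteq> 0"
    proof
      assume "det (M c) = 0"
      then obtain y where y: "y \<in> carrier_vec n" "y \<noteq> 0\<^sub>v n" "M c *\<^sub>v y = 0\<^sub>v n"
        using det_0_iff_vec_prod_zero[OF M] by blast
      have "(\<Sum>j<n. c (orbit_index n x j) * y $ j) = 0" if x: "x \<in> K" for x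
      proof -
        obtain r where r: "r < n" "x = e r" using e x by (force simp: bij_betw_def)
        have "(M c *\<^sub>v y) $ r = 0" using y(3) r by simp
        then show ?thesis using r y(1)
          by (simp add: M_def scalar_prod_def atLeast0LessThan)
      qed
      from c(2)[OF this] have "y = 0\<^sub>v n" using y(1) by (intro eq_vecI) auto
      with y(2) show False by simp
    qed
    then show "\<exists>c\<in>vecs (Cn n). det (M c) \<noteq> 0" using c(1) by blast
    fix c :: "nat \<Rightarrow> complex"
    assume d: "det (M c) \<noteq> 0"
    show "orbit_independent n K c" unfolding orbit_independent_def
    proof (intro allI impI ballI)
      fix a x
      assume z: "\<forall>j<n. (\<Sum>x\<in>K. a x * c (orbit_index n x j)) = 0" and x: "x \<in> K"
      let ?y = "vec n (\<lambda>r. a (e r))"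
      have "transpose_mat (M c) *\<^sub>v ?y = 0\<^sub>v n"
      proof (rule eq_vecI)
        fix j assume "j < dim_vec (0\<^sub>v n :: complex vec)"
        then have j: "j < n" by simp
        have "(transpose_mat (M c) *\<^sub>v ?y) $ j = (\<Sum>r\<in>{0..<n}. a (e r) * c (orbit_index n (e r) j))"
          using j by (simp add: M_def scalar_prod_def mult.commute)
        also have "\<dots> = (\<Sum>x\<in>K. a x * c (orbit_index n x j))" by (rule sum.reindex_bij_betw[OF e])
        finally show "(transpose_mat (M c) *\<^sub>v ?y) $ j = 0\<^sub>v n $ j" using z j by simp
      qed (simp add: M_def)
      moreover have "det (transpose_mat (M c)) \<noteq> 0" using d det_transpose[OF M] by simp
      ultimately have y0: "?y = 0\<^sub>v n"
        using det_0_iff_vec_prod_zero[of "transpose_mat (M c)" n]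
          transpose_carrier_mat[of "M c" n n] M vec_carrier[of n "\<lambda>r. a (e r)"] by blast
      obtain r where r: "r < n" "x = e r" using e x by (force simp: bij_betw_def)
      have "?y $ r = 0" using y0 r by simp
      then show "a x = 0" using r by simp
    qed
  qed
qed

section \<open>Bases and unitary maps\<close>

lemma basis_family_if_independent:
  assumes V: "vector_space (scl V)" and sub: "module.subspace (scl V) (vecs V)"
    and b: "basis_family V J b" "finite J"
    and K: "finite K" "card K = card J" "\<And>x. x \<in> K \<Longrightarrow> f x \<in> vecs V"
    and ind: "\<And>a x. (\<Sum>x\<in>K. scl V (a x) (f x)) = 0 \<Longrightarrow> x \<in> K \<Longrightarrow> a x = 0"
  shows "basis_family V K f"
proof -
  interpret vector_space "scl V" by fact
  have inj: "inj_on f K"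
  proof (rule inj_onI, rule ccontr)
    fix x y assume xy: "x \<in> K" "y \<in> K" "f x = f y" "x \<noteq> y"
    let ?a = "\<lambda>z. if z = x then 1 :: complex else if z = y then - 1 else 0"
    have "(\<Sum>z\<in>K. scl V (?a z) (f z)) = (\<Sum>z\<in>{x, y}. scl V (?a z) (f z))"
      using xy K(1) by (intro sum.mono_neutral_right) auto
    also have "\<dots> = 0" using xy by simp
    finally have "?a x = 0" using ind[of ?a x] xy(1) by blast
    then show False by simp
  qed
  have indep: "independent (f ` K)"
    unfolding dependent_finite[OF finite_imageI[OF K(1)]]
  proof clarsimp
    fix u v
    assume "(\<Sum>v\<in>f ` K. scl V (u v) v) = 0" and v: "v \<in> K" "u (f v) \<noteq> 0"
    then have "(\<Sum>x\<in>K. scl V (u (f x)) (f x)) = 0" using inj by (simp add: sum.reindex)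
    then have "u (f v) = 0" using ind[of "\<lambda>x. u (f x)" v] v(1) by blast
    then show False using v(2) by simp
  qed
  have "span (f ` K) \<subseteq> vecs V" using sub K(3) by (intro span_minimal) auto
  moreover have "v \<in> span (f ` K)" if v: "v \<in> vecs V" for v
  proof (rule ccontr)
    assume nv: "v \<notin> span (f ` K)"
    then have "v \<notin> f ` K" using span_base by blast
    have "independent (insert v (f ` K))" using nv indep by (rule independent_insertI)
    moreover have "insert v (f ` K) \<subseteq> span (b ` J)"
      using b(1) v K(3) by (auto simp: basis_family_def)
    ultimately have "card (insert v (f ` K)) \<le> card (b ` J)"
      using independent_span_bound[OF finite_imageI[OF b(2)]] by blast
    also have "\<dots> = card J" using b(1) by (simp add: basis_family_def card_image)
    finally show False using \<open>v \<notin> f ` K\<close> K(1,2) inj by (simp add: card_image)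
  qed
  ultimately show ?thesis using inj indep by (auto simp: basis_family_def)
qed

lemma basis_family_expansion:
  assumes "vector_space (scl V)" "basis_family V K f" "finite K" "v \<in> vecs V"
  obtains a where "v = (\<Sum>x\<in>K. scl V (a x) (f x))"
proof -
  interpret vector_space "scl V" by fact
  have "v \<in> span (f ` K)" using assms by (simp add: basis_family_def)
  then obtain u where "v = (\<Sum>w\<in>f ` K. scl V (u w) w)"
    unfolding span_finite[OF finite_imageI[OF assms(3)]] by blast
  also have "\<dots> = (\<Sum>x\<in>K. scl V (u (f x)) (f x))"
    using assms(2) by (simp add: basis_family_def sum.reindex)
  finally show ?thesis by (rule that)
qed

lemma hilbert_space_sum_mem:
  assumes "hilbert_space V" "\<And>x. x \<in> K \<Longrightarrow> f x \<in> vecs V"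
  shows "(\<Sum>x\<in>K. scl V (a x) (f x)) \<in> vecs V"
proof -
  interpret vector_space "scl V" using assms(1) by (simp add: hilbert_space_def)
  have "subspace (vecs V)" using assms(1) by (simp add: hilbert_space_def)
  then show ?thesis using assms(2) by (intro subspace_sum subspace_scale) auto
qed

lemma sum_fun_apply: "(\<Sum>x\<in>A. f x) i = (\<Sum>x\<in>A. (f x i :: complex))"
  by (induction A rule: infinite_finite_induct) auto

lemma unitary_map_sum:
  assumes "hilbert_space V" "hilbert_space W" "unitary_map V W U" "finite K"
    and "\<And>x. x \<in> K \<Longrightarrow> f x \<in> vecs V"
  shows "U (\<Sum>x\<in>K. scl V (a x) (f x)) = (\<Sum>x\<in>K. scl W (a x) (U (f x)))"
  using assms(4,5)
proof (induction K rule: finite_induct)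
  case empty
  interpret vector_space "scl V" using assms(1) by (simp add: hilbert_space_def)
  interpret W: vector_space "scl W" using assms(2) by (simp add: hilbert_space_def)
  have "0 \<in> vecs V" using assms(1) by (simp add: hilbert_space_def subspace_0)
  then have "U (scl V 0 0) = scl W 0 (U 0)" using assms(3) unfolding unitary_map_def by blast
  then show ?case by simp
next
  case (insert x K)
  interpret vector_space "scl V" using assms(1) by (simp add: hilbert_space_def)
  have "scl V (a x) (f x) \<in> vecs V" using assms(1) insert.prems
    by (auto simp: hilbert_space_def intro: subspace_scale)
  moreover have "(\<Sum>x\<in>K. scl V (a x) (f x)) \<in> vecs V"
    using insert.prems by (intro hilbert_space_sum_mem assms(1)) auto
  ultimately show ?case using insert assms(3) by (simp add: unitary_map_def)
qed

section \<open>Spanning families are frames\<close>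

lemma ip_sum_left:
  assumes "hilbert_space V" "finite K" "\<And>x. x \<in> K \<Longrightarrow> f x \<in> vecs V" "u \<in> vecs V"
  shows "ip V (\<Sum>x\<in>K. scl V (a x) (f x)) u = (\<Sum>x\<in>K. a x * ip V (f x) u)"
  using assms(2,3)
proof (induction K rule: finite_induct)
  case empty
  interpret vector_space "scl V" using assms(1) by (simp add: hilbert_space_def)
  have "ip V (scl V 0 u) u = 0 * ip V u u" using assms(1,4) unfolding hilbert_space_def by blast
  then show ?case by simp
next
  case (insert x K)
  interpret vector_space "scl V" using assms(1) by (simp add: hilbert_space_def)
  have mem: "f x \<in> vecs V" "scl V (a x) (f x) \<in> vecs V" using assms(1) insert.prems
    by (auto simp: hilbert_space_def intro: subspace_scale)
  have "(\<Sum>x\<in>K. scl V (a x) (f x)) \<in> vecs V"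
    using insert.prems by (intro hilbert_space_sum_mem assms(1)) auto
  then have "ip V (scl V (a x) (f x) + (\<Sum>x\<in>K. scl V (a x) (f x))) u
      = ip V (scl V (a x) (f x)) u + ip V (\<Sum>x\<in>K. scl V (a x) (f x)) u"
    using assms(1,4) mem(2) unfolding hilbert_space_def by blast
  moreover have "ip V (scl V (a x) (f x)) u = a x * ip V (f x) u"
    using assms(1,4) mem(1) unfolding hilbert_space_def by blast
  ultimately show ?case using insert by simp
qed

lemma cmod_ip_commute:
  assumes "hilbert_space V" "u \<in> vecs V" "v \<in> vecs V"
  shows "cmod (ip V u v) = cmod (ip V v u)"
proof -
  have "ip V u v = cnj (ip V v u)" using assms unfolding hilbert_space_def by blast
  then show ?thesis by simp
qed

lemma ip_expansion_bound:
  assumes V: "hilbert_space V" and K: "finite K" "\<And>x. x \<in> K \<Longrightarrow> f x \<in> vecs V"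
    and u: "u \<in> vecs V" and g: "g = (\<Sum>x\<in>K. scl V (a x) (f x))"
  shows "(cmod (ip V u g))\<^sup>2 \<le> (\<Sum>x\<in>K. cmod (a x))\<^sup>2 * (\<Sum>x\<in>K. (cmod (ip V u (f x)))\<^sup>2)"
proof -
  define S where "S = (\<Sum>x\<in>K. (cmod (ip V u (f x)))\<^sup>2)"
  have gV: "g \<in> vecs V" unfolding g using K by (intro hilbert_space_sum_mem V) auto
  have S0: "S \<ge> 0" unfolding S_def by (intro sum_nonneg) auto
  have le: "cmod (ip V (f x) u) \<le> sqrt S" if "x \<in> K" for x
  proof -
    have "(cmod (ip V u (f x)))\<^sup>2 \<le> S" unfolding S_def
      using that K(1) by (intro member_le_sum) auto
    then show ?thesis using cmod_ip_commute[OF V u K(2)[OF that]] by (simp add: real_le_rsqrt)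
  qed
  have "cmod (ip V u g) = cmod (\<Sum>x\<in>K. a x * ip V (f x) u)"
    using cmod_ip_commute[OF V u gV] ip_sum_left[OF V K u, where a = a] by (simp add: g)
  also have "\<dots> \<le> (\<Sum>x\<in>K. cmod (a x * ip V (f x) u))" by (rule norm_sum)
  also have "\<dots> \<le> (\<Sum>x\<in>K. cmod (a x) * sqrt S)"
    using le by (intro sum_mono) (simp add: norm_mult mult_left_mono)
  finally have "cmod (ip V u g) \<le> (\<Sum>x\<in>K. cmod (a x)) * sqrt S" by (simp add: sum_distrib_right)
  then have "(cmod (ip V u g))\<^sup>2 \<le> ((\<Sum>x\<in>K. cmod (a x)) * sqrt S)\<^sup>2" by (rule power_mono) simp
  then show ?thesis using S0 by (simp add: power_mult_distrib S_def[symmetric])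
qed

text \<open>Each \<open>g i\<close> is a fixed combination of the \<open>f x\<close>, which bounds its inner product with \<open>u\<close>. Applied with
  an orthonormal basis as \<open>f\<close> this is the upper frame bound, and as \<open>g\<close> the lower one.\<close>

lemma spanned_families_bound:
  assumes V: "hilbert_space V" and b: "basis_family V K f" and K: "finite K"
    and f: "\<And>x. x \<in> K \<Longrightarrow> f x \<in> vecs V" and g: "\<And>i. i \<in> I \<Longrightarrow> g i \<in> vecs V"
  shows "\<exists>C>0. \<forall>u\<in>vecs V.
    (\<Sum>i\<in>I. (cmod (ip V u (g i)))\<^sup>2) \<le> C * (\<Sum>x\<in>K. (cmod (ip V u (f x)))\<^sup>2)"
proof -
  have vs: "vector_space (scl V)" using V by (simp add: hilbert_space_def)
  have "\<exists>a. g i = (\<Sum>x\<in>K. scl V (a x) (f x))" if "i \<in> I" for i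
    using basis_family_expansion[OF vs b K g[OF that]] by blast
  then obtain a where a: "\<And>i. i \<in> I \<Longrightarrow> g i = (\<Sum>x\<in>K. scl V (a i x) (f x))" by metis
  define C where "C = 1 + (\<Sum>i\<in>I. (\<Sum>x\<in>K. cmod (a i x))\<^sup>2)"
  show ?thesis
  proof (intro exI conjI ballI)
    have "(\<Sum>i\<in>I. (\<Sum>x\<in>K. cmod (a i x))\<^sup>2) \<ge> 0" by (intro sum_nonneg) auto
    then show "C > 0" by (simp add: C_def)
    fix u assume u: "u \<in> vecs V"
    let ?S = "\<Sum>x\<in>K. (cmod (ip V u (f x)))\<^sup>2"
    have "(\<Sum>i\<in>I. (cmod (ip V u (g i)))\<^sup>2) \<le> (\<Sum>i\<in>I. (\<Sum>x\<in>K. cmod (a i x))\<^sup>2 * ?S)"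
      using ip_expansion_bound[OF V K f u a] by (intro sum_mono) auto
    also have "\<dots> = (\<Sum>i\<in>I. (\<Sum>x\<in>K. cmod (a i x))\<^sup>2) * ?S" by (simp only: sum_distrib_right)
    also have "\<dots> \<le> C * ?S" unfolding C_def
      by (intro mult_right_mono sum_nonneg) auto
    finally show "(\<Sum>i\<in>I. (cmod (ip V u (g i)))\<^sup>2) \<le> C * ?S" .
  qed
qed

text \<open>The preimages of the unit vectors form the basis in which coordinates on the space, and
  with them its Zariski topology, are those of \<open>\<complex>\<^sup>n\<close>. It is also the orthonormal basis that computes norms
  in \<open>spanning_family_is_frame\<close>.\<close>

lemma pullback_unit_basis:
  assumes V: "hilbert_space V" and U: "unitary_map V (Cn n) U"
  obtains b where "basis_family V {..<n} b" "\<And>j. j < n \<Longrightarrow> b j \<in> vecs V"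
    "\<And>j. j < n \<Longrightarrow> U (b j) = (\<lambda>i. if i = j then 1 else 0)"
    "\<And>a. U (\<Sum>j<n. scl V (a j) (b j)) = (\<lambda>i. if i < n then a i else 0)"
proof -
  let ?e = "\<lambda>j i. if i = j then 1 else 0 :: complex"
  have vs: "vector_space (scl V)" using V by (simp add: hilbert_space_def)
  interpret vector_space "scl V" by fact
  have bij: "bij_betw U (vecs V) (vecs (Cn n))" using U by (simp add: unitary_map_def)
  have e: "?e j \<in> vecs (Cn n)" if "j < n" for j using that by (auto simp: vecs_Cn)
  define b where "b j = inv_into (vecs V) U (?e j)" for j
  have bV: "b j \<in> vecs V" and Ub: "U (b j) = ?e j" if "j < n" for j
    using bij e[OF that] unfolding b_def bij_betw_def
    by (auto intro: inv_into_into f_inv_into_f)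
  have U_sum: "U (\<Sum>j<n. scl V (a j) (b j)) = (\<lambda>i. if i < n then a i else 0)" for a
  proof -
    have "U (\<Sum>j<n. scl V (a j) (b j)) = (\<Sum>j<n. scl (Cn n) (a j) (U (b j)))"
      using bV by (intro unitary_map_sum V Cn_hilbert U) auto
    also have "\<dots> = (\<Sum>j<n. scl (Cn n) (a j) (?e j))" by (simp add: Ub)
    also have "\<dots> = (\<lambda>i. if i < n then a i else 0)"
      by (rule ext, unfold sum_fun_apply) (simp add: scl_Cn if_distrib cong: if_cong)
    finally show ?thesis .
  qed
  have ex: "\<exists>a. v = (\<Sum>j<n. scl V (a j) (b j))" if v: "v \<in> vecs V" for v
  proof (rule exI, rule inj_onD[OF bij_betw_imp_inj_on[OF bij]])
    have "U v \<in> vecs (Cn n)" using v bij by (auto simp: bij_betw_def)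
    then show "U v = U (\<Sum>j<n. scl V (U v j) (b j))" unfolding U_sum by (auto simp: vecs_Cn fun_eq_iff)
    show "(\<Sum>j<n. scl V (U v j) (b j)) \<in> vecs V" using bV by (intro hilbert_space_sum_mem V) auto
  qed (use v in auto)
  have inj: "inj_on b {..<n}"
  proof (rule inj_onI)
    fix i j assume "i \<in> {..<n}" "j \<in> {..<n}" "b i = b j"
    then have "?e i = ?e j" using Ub by (metis lessThan_iff)
    then have "?e i i = ?e j i" by (rule fun_cong)
    then show "i = j" by (simp split: if_splits)
  qed
  have "independent (b ` {..<n})"
    unfolding dependent_finite[OF finite_imageI[OF finite_lessThan]]
  proof clarsimp
    fix u j assume z: "(\<Sum>v\<in>b ` {..<n}. scl V (u v) v) = 0" and j: "j < n" "u (b j) \<noteq> 0"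
    have "(\<Sum>k<n. scl V (u (b k)) (b k)) = 0" using z inj by (simp add: sum.reindex)
    moreover have "(\<Sum>k<n. scl V 0 (b k)) = 0" by simp
    ultimately have "(\<lambda>i. if i < n then u (b i) else 0) = (\<lambda>i. if i < n then 0 else 0)"
      using U_sum[of "\<lambda>k. u (b k)"] U_sum[of "\<lambda>k. 0"] by simp
    from fun_cong[OF this, of j] show False using j by simp
  qed
  moreover have "span (b ` {..<n}) = vecs V"
  proof
    show "span (b ` {..<n}) \<subseteq> vecs V"
      using V bV by (intro span_minimal) (auto simp: hilbert_space_def)
    show "vecs V \<subseteq> span (b ` {..<n})"
    proof
      fix v assume "v \<in> vecs V"
      then obtain a where "v = (\<Sum>j<n. scl V (a j) (b j))" using ex by blast
      then show "v \<in> span (b ` {..<n})"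
        by (simp only:) (intro span_sum span_scale span_base imageI)
    qed
  qed
  ultimately show ?thesis using that[of b] bV Ub U_sum inj by (simp add: basis_family_def)
qed

lemma spanning_family_is_frame:
  assumes V: "hilbert_space V" and U: "unitary_map V (Cn n) U"
    and I: "finite I" "\<And>i. i \<in> I \<Longrightarrow> g i \<in> vecs V" and K: "K \<subseteq> I" "basis_family V K g"
  shows "is_frame V I g"
proof -
  obtain b where b: "basis_family V {..<n} b" "\<And>j. j < n \<Longrightarrow> b j \<in> vecs V"
    "\<And>j. j < n \<Longrightarrow> U (b j) = (\<lambda>i. if i = j then 1 else 0)"
    "\<And>a. U (\<Sum>j<n. scl V (a j) (b j)) = (\<lambda>i. if i < n then a i else 0)"
    by (rule pullback_unit_basis[OF V U], rule that)
  have finK: "finite K" using K(1) I(1) by (rule finite_subset)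
  have gK: "g i \<in> vecs V" if "i \<in> K" for i using that I(2) K(1) by blast
  have norm: "Re (ip V u u) = (\<Sum>j<n. (cmod (ip V u (b j)))\<^sup>2)" if u: "u \<in> vecs V" for u
  proof -
    have iso: "ip V u v = ip (Cn n) (U u) (U v)" if "v \<in> vecs V" for v
      using U u that by (simp add: unitary_map_def)
    have "ip V u (b j) = U u j" if "j < n" for j
    proof -
      have "ip V u (b j) = (\<Sum>i<n. U u i * cnj (if i = j then 1 else 0))"
        using that by (simp add: iso b ip_Cn)
      also have "\<dots> = (\<Sum>i<n. if i = j then U u j else 0)" by (intro sum.cong) auto
      finally show ?thesis using that by simp
    qed
    moreover have "Re (ip V u u) = (\<Sum>j<n. (cmod (U u j))\<^sup>2)"
      using u by (simp add: iso ip_Cn cmod_power2 flip: power2_eq_square)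
    ultimately show ?thesis by simp
  qed
  have "\<exists>B>0. \<forall>u\<in>vecs V.
      (\<Sum>i\<in>I. (cmod (ip V u (g i)))\<^sup>2) \<le> B * (\<Sum>j<n. (cmod (ip V u (b j)))\<^sup>2)"
    by (rule spanned_families_bound[OF V b(1) finite_lessThan]) (simp_all add: b(2) I(2))
  then obtain B where B: "B > 0" "\<And>u. u \<in> vecs V \<Longrightarrow>
      (\<Sum>i\<in>I. (cmod (ip V u (g i)))\<^sup>2) \<le> B * (\<Sum>j<n. (cmod (ip V u (b j)))\<^sup>2)"
    by blast
  have "\<exists>C>0. \<forall>u\<in>vecs V.
      (\<Sum>j<n. (cmod (ip V u (b j)))\<^sup>2) \<le> C * (\<Sum>i\<in>K. (cmod (ip V u (g i)))\<^sup>2)"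
    by (rule spanned_families_bound[OF V K(2) finK]) (simp_all add: b(2) gK)
  then obtain C where C: "C > 0" "\<And>u. u \<in> vecs V \<Longrightarrow>
      (\<Sum>j<n. (cmod (ip V u (b j)))\<^sup>2) \<le> C * (\<Sum>i\<in>K. (cmod (ip V u (g i)))\<^sup>2)"
    by blast
  have "(1 / C) * Re (ip V u u) \<le> (\<Sum>i\<in>I. (cmod (ip V u (g i)))\<^sup>2)" if u: "u \<in> vecs V" for u
  proof -
    have "Re (ip V u u) \<le> C * (\<Sum>i\<in>K. (cmod (ip V u (g i)))\<^sup>2)" using C(2)[OF u] norm[OF u] by simp
    also have "\<dots> \<le> C * (\<Sum>i\<in>I. (cmod (ip V u (g i)))\<^sup>2)"
      using C(1) I(1) K(1) by (intro mult_left_mono sum_mono2) auto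
    finally show ?thesis using C(1) by (simp add: field_simps)
  qed
  moreover have "(\<Sum>i\<in>I. (cmod (ip V u (g i)))\<^sup>2) \<le> B * Re (ip V u u)" if "u \<in> vecs V" for u
    using B(2)[OF that] norm[OF that] by simp
  moreover have "1 / C > 0" using C(1) by simp
  ultimately show ?thesis unfolding is_frame_def using I B(1) by blast
qed

text \<open>After deletion at least \<open>hdim V\<close> vectors remain; any \<open>hdim V\<close> of them form a basis.\<close>

lemma haar_imp_max_robust_frame:
  assumes V: "hilbert_space V" and U: "unitary_map V (Cn n) U"
    and G: "finite (carrier G)" and mem: "\<And>x. x \<in> carrier G \<Longrightarrow> \<alpha> x v \<in> vecs V"
    and haar: "haar_property G V \<alpha> v"
  shows "max_robust_frame V (carrier G) (\<lambda>x. \<alpha> x v)"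
proof -
  have frame: "is_frame V (carrier G - L) (\<lambda>x. \<alpha> x v)"
    if "L \<subseteq> carrier G" "card L + hdim V \<le> card (carrier G)" for L
  proof -
    have "hdim V \<le> card (carrier G - L)"
      using that(2) card_Diff_subset[OF finite_subset[OF that(1) G] that(1)] by simp
    then obtain K where K: "K \<subseteq> carrier G - L" "card K = hdim V"
      by (rule obtain_subset_with_card_n)
    then have basis: "basis_family V K (\<lambda>x. \<alpha> x v)" using haar unfolding haar_property_def by blast
    show ?thesis
      by (rule spanning_family_is_frame[OF V U _ _ K(1) basis]) (use G mem in auto)
  qed
  have "is_frame V (carrier G) (\<lambda>x. \<alpha> x v)"
    using frame[of "{}"] haar by (simp add: haar_property_def)
  then show ?thesis using frame unfolding max_robust_frame_def by blast
qed

section \<open>The dihedral orbit\<close>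

lemma orbit_transport:
  assumes V: "hilbert_space V" and U: "unitary_map V (Cn n) U"
    and mem: "\<And>x. x \<in> carrier (dihedral n) \<Longrightarrow> \<alpha> x v \<in> vecs V"
    and eq: "\<And>x. x \<in> carrier (dihedral n) \<Longrightarrow> U (\<alpha> x v) = kappa n x (U v)"
    and v: "v \<in> vecs V" and K: "finite K" "K \<subseteq> carrier (dihedral n)" and j: "j < n"
  shows "U (\<Sum>x\<in>K. scl V (a x) (\<alpha> x v)) j = (\<Sum>x\<in>K. a x * U v (orbit_index n x j))"
proof -
  have Uv: "U v \<in> vecs (Cn n)" using U v by (auto simp: unitary_map_def bij_betw_def)
  have "U (\<Sum>x\<in>K. scl V (a x) (\<alpha> x v)) = (\<Sum>x\<in>K. scl (Cn n) (a x) (U (\<alpha> x v)))"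
    using mem K by (intro unitary_map_sum V Cn_hilbert U) auto
  then have "U (\<Sum>x\<in>K. scl V (a x) (\<alpha> x v)) j = (\<Sum>x\<in>K. scl (Cn n) (a x) (U (\<alpha> x v)) j)"
    by (simp only: sum_fun_apply)
  also have "\<dots> = (\<Sum>x\<in>K. a x * U v (orbit_index n x j))"
    using K j by (intro sum.cong) (auto simp: eq scl_Cn kappa_coordinate[OF Uv] subset_eq)
  finally show ?thesis .
qed

theorem theorem1:
  fixes n :: nat
    and V :: "'h::ab_group_add ip_space"
    and \<alpha> :: "nat \<times> bool \<Rightarrow> 'h \<Rightarrow> 'h"
  assumes "n > 2"
    and "hilbert_space V"
    and "unitary_rep (dihedral n) V \<alpha>"
    and "unitarily_equivalent (dihedral n) V \<alpha> (Cn n) (kappa n)"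
  shows "(even n \<longrightarrow> \<not> (\<exists>v\<in>vecs V. haar_property (dihedral n) V \<alpha> v)) \<and>
         (prime n \<longrightarrow> (\<exists>E. E \<noteq> {} \<and> zariski_open V E \<and>
            (\<forall>v\<in>E. haar_property (dihedral n) V \<alpha> v))) \<and>
         (prime n \<longrightarrow> (\<exists>E. E \<noteq> {} \<and> zariski_open V E \<and>
            (\<forall>v\<in>E. max_robust_frame V (carrier (dihedral n)) (\<lambda>x. \<alpha> x v))))"
proof -
  note n = assms(1) and V = assms(2)
  obtain U where U: "unitary_map V (Cn n) U"
    and eq: "\<And>x v. x \<in> carrier (dihedral n) \<Longrightarrow> v \<in> vecs V \<Longrightarrow> U (\<alpha> x v) = kappa n x (U v)"
    using assms(4) unfolding unitarily_equivalent_def by blast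
  have bij: "bij_betw U (vecs V) (vecs (Cn n))" using U by (simp add: unitary_map_def)
  have mem: "\<alpha> x v \<in> vecs V" if "x \<in> carrier (dihedral n)" "v \<in> vecs V" for x v
  proof -
    have "bij_betw (\<alpha> x) (vecs V) (vecs V)"
      using assms(3) that(1) unfolding unitary_rep_def unitary_map_def by blast
    then show ?thesis using that(2) by (rule bij_betw_apply)
  qed
  have vs: "vector_space (scl V)" and sub: "module.subspace (scl V) (vecs V)"
    using V by (simp_all add: hilbert_space_def)
  obtain b where b: "basis_family V {..<n} b" "\<And>j. j < n \<Longrightarrow> b j \<in> vecs V"
    "\<And>j. j < n \<Longrightarrow> U (b j) = (\<lambda>i. if i = j then 1 else 0)"
    "\<And>a. U (\<Sum>j<n. scl V (a j) (b j)) = (\<lambda>i. if i < n then a i else 0)"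
    using pullback_unit_basis[OF V U] by blast
  have dim: "hdim V = n" using basis_family_hdim[OF vs b(1)] by simp
  have fin: "finite (carrier (dihedral n))" by (simp add: dihedral_simps)
  have coords: "U (\<Sum>x\<in>K. scl V (a x) (\<alpha> x v)) j = (\<Sum>x\<in>K. a x * U v (orbit_index n x j))"
    if "v \<in> vecs V" "K \<subseteq> carrier (dihedral n)" "j < n" for v K a j
    by (rule orbit_transport[OF V U]) (simp_all add: mem eq that finite_subset[OF that(2) fin])

  have no_haar: "\<not> haar_property (dihedral n) V \<alpha> v" if even: "even n" and v: "v \<in> vecs V" for v
  proof
    assume haar: "haar_property (dihedral n) V \<alpha> v"
    define K where "K = {i. i < n \<and> even i} \<times> (UNIV :: bool set)"
    have K: "K \<subseteq> carrier (dihedral n)" by (auto simp: K_def dihedral_simps)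
    obtain m where m: "n = 2 * m" using even by (rule evenE)
    have "{i. i < n \<and> even i} = (\<lambda>i. 2 * i) ` {..<m}" by (auto simp: m elim!: evenE)
    then have "card {i. i < n \<and> even i} = m" by (simp add: card_image inj_on_def)
    then have "card K = n" by (simp add: K_def m card_cartesian_product)
    then have basis: "basis_family V K (\<lambda>x. \<alpha> x v)" using haar K by (simp add: haar_property_def dim)
    have "n > 0" using n by simp
    then obtain g j0 where g: "j0 < n" "g j0 \<noteq> 0"
      "\<And>x. even (fst x) \<Longrightarrow> (\<Sum>j<n. g j * U v (orbit_index n x j)) = 0"
      using even_orbit_functional[OF even, of "U v"] by blast
    obtain a where a: "b j0 = (\<Sum>x\<in>K. scl V (a x) (\<alpha> x v))"
      using basis_family_expansion[OF vs basis finite_subset[OF K fin] b(2)[OF g(1)]] by blast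
    have "g j0 = (\<Sum>j<n. if j = j0 then g j0 else 0)" using g(1) by simp
    also have "\<dots> = (\<Sum>j<n. g j * U (b j0) j)" by (intro sum.cong) (auto simp: b(3)[OF g(1)])
    also have "\<dots> = (\<Sum>j<n. \<Sum>x\<in>K. a x * (g j * U v (orbit_index n x j)))"
      by (intro sum.cong) (auto simp: a coords[OF v K] sum_distrib_left mult.left_commute)
    also have "\<dots> = (\<Sum>x\<in>K. a x * (\<Sum>j<n. g j * U v (orbit_index n x j)))"
      by (subst sum.swap) (simp add: sum_distrib_left)
    also have "\<dots> = 0" by (intro sum.neutral) (auto simp: K_def g(3))
    finally show False using g(2) by simp
  qed

  have open_haar: "\<exists>E. E \<noteq> {} \<and> zariski_open V E \<and> E \<subseteq> vecs V \<and> (\<forall>v\<in>E. haar_property (dihedral n) V \<alpha> v)"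
    if p: "prime n"
  proof -
    define \<K> where "\<K> = {K. K \<subseteq> carrier (dihedral n) \<and> card K = n}"
    have "\<forall>K\<in>\<K>. \<exists>P. P \<in> polynomial_fun n \<and> (\<exists>c\<in>vecs (Cn n). P c \<noteq> 0) \<and>
        (\<forall>c. P c \<noteq> 0 \<longrightarrow> orbit_independent n K c)"
      using orbit_minor_polynomial[OF p n] unfolding \<K>_def Bex_def by blast
    from bchoice[OF this] obtain P where P: "\<forall>K\<in>\<K>. P K \<in> polynomial_fun n \<and>
        (\<exists>c\<in>vecs (Cn n). P K c \<noteq> 0) \<and> (\<forall>c. P K c \<noteq> 0 \<longrightarrow> orbit_independent n K c)" ..
    have fin\<K>: "finite \<K>" unfolding \<K>_def using fin by simp
    define Q where "Q c = (\<Prod>K\<in>\<K>. P K c)" for c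
    have Q: "Q \<in> polynomial_fun n" unfolding Q_def[abs_def] using P by (intro polynomial_fun_prod) blast
    define E where "E = {v \<in> vecs V. Q (U v) \<noteq> 0}"
    obtain c where c: "c \<in> vecs (Cn n)" "Q c \<noteq> 0"
      using polynomial_fun_prod_nonzero[OF fin\<K>, of P n] P unfolding Q_def by fast
    obtain v where "v \<in> vecs V" "U v = c" using bij c(1) by (metis bij_betw_imp_surj_on imageE)
    then have ne: "E \<noteq> {}" using c by (auto simp: E_def)
    have "zariski_open V E"
      unfolding zariski_open_def dim
    proof (intro conjI exI)
      show "E \<subseteq> vecs V" by (auto simp: E_def)
      show "basis_family V {..<n} b" by (rule b(1))
      have fc: "from_coords V b c \<in> vecs V" "U (from_coords V b c) = c" if c: "c \<in> vecs (Cn n)" for c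
      proof -
        show "from_coords V b c \<in> vecs V" unfolding from_coords_def dim
          using b(2) by (intro hilbert_space_sum_mem V) auto
        show "U (from_coords V b c) = c"
          unfolding from_coords_def dim b(4) using c by (auto simp: vecs_Cn fun_eq_iff)
      qed
      show "zariski_closed_Cn n {c \<in> vecs (Cn n). from_coords V b c \<notin> E}"
        unfolding zariski_closed_Cn_def
        using Q fc by (intro exI[of _ "{Q}"]) (auto simp: E_def)
    qed
    moreover have "haar_property (dihedral n) V \<alpha> v" if v: "v \<in> E" for v
      unfolding haar_property_def dim dihedral_order
    proof (intro conjI allI impI)
      fix K assume K: "K \<subseteq> carrier (dihedral n)" "card K = n"
      have vV: "v \<in> vecs V" "Q (U v) \<noteq> 0" using v by (auto simp: E_def)
      have K\<K>: "K \<in> \<K>" using K by (simp add: \<K>_def)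
      have "P K (U v) \<noteq> 0" using vV(2) K\<K> fin\<K> by (auto simp: Q_def)
      then have ind: "orbit_independent n K (U v)" using P K\<K> by blast
      have U0: "U 0 = 0"
        using unitary_map_sum[OF V Cn_hilbert U finite.emptyI, of "\<lambda>x. x" "\<lambda>x. 0"] by simp
      show "basis_family V K (\<lambda>x. \<alpha> x v)"
      proof (rule basis_family_if_independent[OF vs sub b(1)])
        fix a x assume z: "(\<Sum>x\<in>K. scl V (a x) (\<alpha> x v)) = 0" and x: "x \<in> K"
        have "(\<Sum>x\<in>K. a x * U v (orbit_index n x j)) = 0" if "j < n" for j
          using coords[OF vV(1) K(1) that, of a] by (simp add: z U0)
        then show "a x = 0" using ind x unfolding orbit_independent_def by blast
      qed (use K fin mem vV(1) finite_subset in auto)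
    qed simp
    ultimately show ?thesis using ne by (intro exI[of _ E]) (auto simp: E_def)
  qed

  have open_robust: "\<exists>E. E \<noteq> {} \<and> zariski_open V E \<and>
      (\<forall>v\<in>E. max_robust_frame V (carrier (dihedral n)) (\<lambda>x. \<alpha> x v))" if p: "prime n"
  proof -
    obtain E where E: "E \<noteq> {}" "zariski_open V E" "E \<subseteq> vecs V"
      "\<And>v. v \<in> E \<Longrightarrow> haar_property (dihedral n) V \<alpha> v"
      using open_haar[OF p] by blast
    have "max_robust_frame V (carrier (dihedral n)) (\<lambda>x. \<alpha> x v)" if "v \<in> E" for v
      using that E(3) mem by (intro haar_imp_max_robust_frame[OF V U fin _ E(4)]) auto
    then show ?thesis using E by blast
  qed
  show ?thesis using no_haar open_haar open_robust by blast
qed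

end
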